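(* Up to homeomorphism, the generalized Baire space ${}^{\kappa}\kappa$ is the unique nonempty $\kappa$-additive $\mathrm{SC}_\kappa$-space for which all $\kappa$-Lindelöf subsets have empty interior. Equivalently, it is, up to homeomorphism, the unique nonempty $\kappa$-additive $\mathrm{SC}_\kappa$-space for which all $K_\kappa$-subsets have empty interior.
   Context: Work in ZFC; $\kappa$ is an uncountable regular cardinal with $2^{<\kappa}=\kappa$ (equivalently $\kappa^{<\kappa}=\kappa$). "Space" means regular Hausdorff topological space. ${}^{\kappa}\kappa$ is the set of all functions $\kappa\to\kappa$ with the bounded topology, generated by the sets $\{x\in{}^{\kappa}\kappa \mid s\subseteq x\}$, $s\in{}^{<\kappa}\kappa$. A space is $\kappa$-additive if its topology is closed under intersections of fewer than $\kappa$ open sets. A space (or a subset of a space, with the relative topology) is $\kappa$-Lindelöf if every open cover of it has a subcover of size $<\kappa$. A $K_\kappa$-set is a union of $\kappa$-many $\kappa$-Lindelöf sets. Strong $\kappa$-Choquet game $\mathrm{G}^s_\kappa(X)$: players I and II play $\kappa$-many rounds. In round $\alpha<\kappa$, I plays $(U_\alpha,x_\alpha)$ with $U_\alpha$ a relatively open subset of $\bigcap_{\beta<\alpha}V_\beta$ (which is $X$ if $\alpha=0$) and $x_\alpha\in U_\alpha$; then II plays a relatively open subset $V_\alpha$ of $\bigcap_{\beta<\alpha}V_\beta$ with $x_\alpha\in V_\alpha\subseteq U_\alpha$. II wins iff $\bigcap_{\alpha<\gamma}V_\alpha\ne\emptyset$ for every limit $\gamma\le\kappa$ (I wins as soon as such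 an intersection is empty). $X$ is an $\mathrm{SC}_\kappa$-space if it has weight $\le\kappa$ and II has a winning strategy in $\mathrm{G}^s_\kappa(X)$. *)

theory Defs
  imports "HOL-Analysis.Analysis"
begin

unbundle cardinal_syntax

text \<open>
  A cardinal is given, as in the BNF cardinal library, by a relation \<open>\<kappa> :: 'k rel\<close> with
  \<open>Card_order \<kappa>\<close>. The ordinals below \<open>\<kappa>\<close> are the elements \<open>\<alpha>\<close> of \<open>Field \<kappa>\<close>, and \<open>underS \<kappa> \<alpha>\<close> is the
  set of ordinals less than \<open>\<alpha>\<close>. The ordinals less than or equal to \<open>\<kappa>\<close> are the sets \<open>D\<close> with
  \<open>ofilter \<kappa> D\<close>, that is, the initial segments of \<open>Field \<kappa>\<close>, including \<open>Field \<kappa>\<close> itself.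
\<close>

text \<open>\<open>2\<^bsup><\<kappa>\<^esup>\<close> is the number of binary sequences of length less than \<open>\<kappa>\<close>; for infinite \<open>\<kappa>\<close>
  it is also the supremum of the cardinals \<open>2\<^bsup>\<bar>\<alpha>\<bar>\<^esup>\<close> for \<open>\<alpha> < \<kappa>\<close>.\<close>

definition two_power_less :: "'k rel \<Rightarrow> ('k \<times> ('k \<Rightarrow> bool)) rel" where
  "two_power_less \<kappa> = BNF_Cardinal_Arithmetic.Csum \<kappa> (\<lambda>\<alpha>. ctwo ^c |underS \<kappa> \<alpha>| )"

definition generalized_Baire_space :: "'k rel \<Rightarrow> ('k \<Rightarrow> 'k) topology" where
  "generalized_Baire_space \<kappa> =
     topology_generated_by
       {{x \<in> Field \<kappa> \<rightarrow>\<^sub>E Field \<kappa>. restrict x (underS \<kappa> \<alpha>) = s} | \<alpha> s.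
          \<alpha> \<in> Field \<kappa> \<and> s \<in> underS \<kappa> \<alpha> \<rightarrow>\<^sub>E Field \<kappa>}"

definition kappa_additive :: "'k rel \<Rightarrow> 'a topology \<Rightarrow> bool" where
  "kappa_additive \<kappa> X \<longleftrightarrow>
     (\<forall>\<U>. (\<forall>U\<in>\<U>. openin X U) \<and> |\<U>| <o \<kappa> \<longrightarrow> openin X (topspace X \<inter> \<Inter>\<U>))"

definition kappa_Lindelof_space :: "'k rel \<Rightarrow> 'a topology \<Rightarrow> bool" where
  "kappa_Lindelof_space \<kappa> X \<longleftrightarrow>
     (\<forall>\<U>. (\<forall>U\<in>\<U>. openin X U) \<and> \<Union>\<U> = topspace X
        \<longrightarrow> (\<exists>\<V>. |\<V>| <o \<kappa> \<and> \<V> \<subseteq> \<U> \<and> \<Union>\<V> = topspace X))"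

definition kappa_Lindelof_in :: "'k rel \<Rightarrow> 'a topology \<Rightarrow> 'a set \<Rightarrow> bool" where
  "kappa_Lindelof_in \<kappa> X S \<longleftrightarrow> S \<subseteq> topspace X \<and> kappa_Lindelof_space \<kappa> (subtopology X S)"

definition K_kappa_in :: "'k rel \<Rightarrow> 'a topology \<Rightarrow> 'a set \<Rightarrow> bool" where
  "K_kappa_in \<kappa> X S \<longleftrightarrow>
     (\<exists>L. (\<forall>\<alpha>\<in>Field \<kappa>. kappa_Lindelof_in \<kappa> X (L \<alpha>)) \<and> S = (\<Union>\<alpha>\<in>Field \<kappa>. L \<alpha>))"

definition weight_le :: "'k rel \<Rightarrow> 'a topology \<Rightarrow> bool" where
  "weight_le \<kappa> X \<longleftrightarrow>
     (\<exists>\<B>. |\<B>| \<le>o \<kappa> \<and> (\<forall>V\<in>\<B>. openin X V) \<and>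
          (\<forall>U x. openin X U \<and> x \<in> U \<longrightarrow> (\<exists>V\<in>\<B>. x \<in> V \<and> V \<subseteq> U)))"

text \<open>
  In the strong Choquet game of length \<open>\<kappa>\<close>, player I plays \<open>(U \<alpha>, x \<alpha>)\<close> and player II plays \<open>V \<alpha>\<close> in
  round \<open>\<alpha>\<close>.
\<close>

definition choquet_remaining :: "'k rel \<Rightarrow> 'a topology \<Rightarrow> ('k \<Rightarrow> 'a set) \<Rightarrow> 'k \<Rightarrow> 'a set" where
  "choquet_remaining \<kappa> X V \<alpha> = topspace X \<inter> (\<Inter>\<beta>\<in>underS \<kappa> \<alpha>. V \<beta>)"

definition choquet_legal_I ::
    "'k rel \<Rightarrow> 'a topology \<Rightarrow> ('k \<Rightarrow> 'a set) \<Rightarrow> ('k \<Rightarrow> 'a) \<Rightarrow> ('k \<Rightarrow> 'a set) \<Rightarrow> 'k \<Rightarrow> bool" where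
  "choquet_legal_I \<kappa> X U x V \<alpha> \<longleftrightarrow>
     openin (subtopology X (choquet_remaining \<kappa> X V \<alpha>)) (U \<alpha>) \<and> x \<alpha> \<in> U \<alpha>"

definition choquet_legal_II ::
    "'k rel \<Rightarrow> 'a topology \<Rightarrow> ('k \<Rightarrow> 'a set) \<Rightarrow> ('k \<Rightarrow> 'a) \<Rightarrow> ('k \<Rightarrow> 'a set) \<Rightarrow> 'k \<Rightarrow> bool" where
  "choquet_legal_II \<kappa> X U x V \<alpha> \<longleftrightarrow>
     openin (subtopology X (choquet_remaining \<kappa> X V \<alpha>)) (V \<alpha>) \<and> x \<alpha> \<in> V \<alpha> \<and> V \<alpha> \<subseteq> U \<alpha>"

text \<open>\<open>D\<close> is a nonzero limit ordinal \<open>\<gamma> \<le> \<kappa>\<close>.\<close>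

definition limit_segment :: "'k rel \<Rightarrow> 'k set \<Rightarrow> bool" where
  "limit_segment \<kappa> D \<longleftrightarrow>
     ofilter \<kappa> D \<and> D \<noteq> {} \<and> (\<forall>\<alpha>\<in>D. \<exists>\<beta>\<in>D. \<alpha> \<in> underS \<kappa> \<beta>)"

text \<open>
  A strategy for II maps a round \<open>\<alpha>\<close>, the moves of I in the rounds up to and including \<open>\<alpha>\<close> and the
  moves of II in the rounds before \<open>\<alpha>\<close> to II's move in round \<open>\<alpha>\<close>.
\<close>

type_synonym ('k, 'a) choquet_strategy =
  "'k \<Rightarrow> ('k \<Rightarrow> 'a set) \<Rightarrow> ('k \<Rightarrow> 'a) \<Rightarrow> ('k \<Rightarrow> 'a set) \<Rightarrow> 'a set"

definition choquet_follows ::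
    "'k rel \<Rightarrow> ('k, 'a) choquet_strategy
      \<Rightarrow> ('k \<Rightarrow> 'a set) \<Rightarrow> ('k \<Rightarrow> 'a) \<Rightarrow> ('k \<Rightarrow> 'a set) \<Rightarrow> 'k \<Rightarrow> bool" where
  "choquet_follows \<kappa> \<sigma> U x V \<alpha> \<longleftrightarrow>
     V \<alpha> = \<sigma> \<alpha> (restrict U (under \<kappa> \<alpha>)) (restrict x (under \<kappa> \<alpha>)) (restrict V (underS \<kappa> \<alpha>))"

text \<open>
  The quantification is over runs of every length \<open>D \<le> \<kappa>\<close>, not only over those of length \<open>\<kappa>\<close>: once the
  intersection of the sets played by II at a limit below \<open>\<kappa>\<close> is empty, I has won, but has no
  further legal move, so such a run does not extend to a legal run of length \<open>\<kappa>\<close>.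
\<close>

definition choquet_winning_II ::
    "'k rel \<Rightarrow> 'a topology \<Rightarrow> ('k, 'a) choquet_strategy \<Rightarrow> bool" where
  "choquet_winning_II \<kappa> X \<sigma> \<longleftrightarrow>
     (\<forall>D U x V. ofilter \<kappa> D \<and>
        (\<forall>\<alpha>\<in>D. choquet_legal_I \<kappa> X U x V \<alpha> \<and> choquet_follows \<kappa> \<sigma> U x V \<alpha>) \<longrightarrow>
        (\<forall>\<alpha>\<in>D. choquet_legal_II \<kappa> X U x V \<alpha>) \<and>
        (limit_segment \<kappa> D \<longrightarrow> (\<Inter>\<alpha>\<in>D. V \<alpha>) \<noteq> {}))"

text \<open>All spaces are understood to be regular and Hausdorff, so this is part of the definition.\<close>

definition SC_space :: "'k rel \<Rightarrow> 'a topology \<Rightarrow> bool" where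
  "SC_space \<kappa> X \<longleftrightarrow>
     regular_space X \<and> Hausdorff_space X \<and> weight_le \<kappa> X \<and> (\<exists>\<sigma>. choquet_winning_II \<kappa> X \<sigma>)"

definition Lindelof_sets_empty_interior :: "'k rel \<Rightarrow> 'a topology \<Rightarrow> bool" where
  "Lindelof_sets_empty_interior \<kappa> X \<longleftrightarrow>
     (\<forall>L. kappa_Lindelof_in \<kappa> X L \<longrightarrow> X interior_of L = {})"

definition K_kappa_sets_empty_interior :: "'k rel \<Rightarrow> 'a topology \<Rightarrow> bool" where
  "K_kappa_sets_empty_interior \<kappa> X \<longleftrightarrow>
     (\<forall>K. K_kappa_in \<kappa> X K \<longrightarrow> X interior_of K = {})"

end

theory Submission
  imports Defs
begin

text \<open>
  The generalized Baire space has the listed properties for the following reasons. Its cylinders (the sets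
  of all extensions of a stem of length less than \<open>\<kappa>\<close>) are a clopen base, of size \<open>\<kappa>\<close> because
  \<open>2\<^bsup><\<kappa>\<^esup> = \<kappa>\<close> and regularity give \<open>\<kappa>\<^bsup><\<kappa>\<^esup> = \<kappa>\<close>. Fewer than \<open>\<kappa>\<close> many cylinders around one point have
  bounded lengths, hence contain a common one; this is additivity. In the strong Choquet game II
  answers with a cylinder around the point played: a decreasing chain of cylinders has a common point,
  obtained by gluing the stems. Finally a \<open>\<kappa>\<close>-Lindelof set takes fewer than \<open>\<kappa>\<close> values at each coordinate, so
  a sequence with a given stem can avoid \<open>\<kappa>\<close> many such sets by avoiding each at a coordinate of its own.
  So already the \<open>K\<^sub>\<kappa>\<close>-sets have empty interior.

  Conversely let \<open>X\<close> be a nonempty \<open>\<kappa>\<close>-additive \<open>SC\<^sub>\<kappa>\<close>-space in which \<open>\<kappa>\<close>-Lindelof sets have empty interior.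
  As every \<open>\<kappa>\<close>-Lindelof set is a \<open>K\<^sub>\<kappa>\<close>-set, this covers both versions of the theorem. Since \<open>\<kappa>\<close> is uncountable,
  additivity and regularity make \<open>X\<close> zero-dimensional, with a clopen base \<open>b\<close> indexed by \<open>\<kappa>\<close>
  (\<open>clopen_base\<close>). The space \<open>X\<close> is split repeatedly, along a tree of height \<open>\<kappa>\<close> in which every node has \<open>\<kappa>\<close>
  successors. Each node \<open>A\<close> at level \<open>\<alpha>\<close> is a nonempty open set and comes with a run of the game in which I
  has played the nodes above \<open>A\<close>, with suitable points, and II has followed a winning strategy. If I now
  plays \<open>(A, z)\<close>, II answers with a neighbourhood of \<open>z\<close>. These neighbourhoods, for all \<open>z\<close> in \<open>A\<close>, intersected
  with \<open>b \<alpha>\<close> or its complement, cover \<open>A\<close>. As \<open>A\<close> is not \<open>\<kappa>\<close>-Lindelof, it has a partition into exactly \<open>\<kappa>\<close> many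
  nonempty open sets subordinate to this cover (\<open>ex_open_partition\<close>), and these are the successors of \<open>A\<close>.
  At limits one takes intersections. They are open by additivity, and nonempty because the nodes
  alternate with the moves of II (\<open>branch_limit\<close>).

  The same argument at height \<open>\<kappa>\<close> shows that the sets along each branch have a common point. It is unique
  because level \<open>\<alpha> + 1\<close> decides membership in \<open>b \<alpha>\<close>. Every point is on exactly one branch, since the
  successors partition each node. The resulting bijection between \<open>\<kappa>\<close>-sequences of indices and points of
  \<open>X\<close> maps cylinders to nodes (\<open>image_cylinder\<close>), and the nodes are a base of \<open>X\<close>. So it is a homeomorphism.
\<close>

section \<open>Uncountable regular cardinals\<close>

locale uncountable_regular =
  fixes \<kappa> :: "'k rel"
  assumes Card_order: "Card_order \<kappa>"
    and uncountable: "natLeq <o \<kappa>"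
    and regular: "regularCard \<kappa>"
begin

lemma Well_order: "Well_order \<kappa>"
  using Card_order by (simp add: card_order_on_def)

lemma wo_rel: "wo_rel \<kappa>"
  using Well_order by (simp add: wo_rel_def)

lemma infinite_Field: "infinite (Field \<kappa>)"
proof -
  have "natLeq \<le>o |Field \<kappa>|"
    using uncountable card_of_Field_ordIso[OF Card_order]
    by (meson ordIso_symmetric ordLeq_ordIso_trans ordLess_imp_ordLeq)
  then show ?thesis
    using infinite_iff_natLeq_ordLeq by blast
qed

lemma stable: "stable \<kappa>"
  using regularCard_stable Card_order infinite_Field regular by blast

lemma Field_nonempty: "Field \<kappa> \<noteq> {}"
  using infinite_Field by auto

lemma underS_FieldD: "\<alpha> \<in> underS \<kappa> \<beta> \<Longrightarrow> \<alpha> \<in> Field \<kappa>"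
  "\<alpha> \<in> underS \<kappa> \<beta> \<Longrightarrow> \<beta> \<in> Field \<kappa>"
  by (auto simp: underS_def Field_def)

lemma underS_trans: "\<alpha> \<in> underS \<kappa> \<beta> \<Longrightarrow> \<beta> \<in> underS \<kappa> \<gamma> \<Longrightarrow> \<alpha> \<in> underS \<kappa> \<gamma>"
  using wo_rel.TRANS[OF wo_rel] wo_rel.ANTISYM[OF wo_rel]
  by (auto simp: underS_def trans_def antisym_def)

lemma underS_irrefl: "\<alpha> \<notin> underS \<kappa> \<alpha>"
  by (simp add: underS_def)

lemma underS_linear:
  "\<alpha> \<in> Field \<kappa> \<Longrightarrow> \<beta> \<in> Field \<kappa> \<Longrightarrow> \<alpha> \<in> underS \<kappa> \<beta> \<or> \<alpha> = \<beta> \<or> \<beta> \<in> underS \<kappa> \<alpha>"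
  using wo_rel.TOTALS[OF wo_rel] by (auto simp: underS_def)

lemma under_eq: "\<alpha> \<in> Field \<kappa> \<Longrightarrow> under \<kappa> \<alpha> = insert \<alpha> (underS \<kappa> \<alpha>)"
  using wo_rel.REFL[OF wo_rel] by (auto simp: underS_def under_def refl_on_def)

lemma less_induct [consumes 1, case_names less]:
  assumes "\<alpha> \<in> Field \<kappa>"
    and "\<And>\<alpha>. \<alpha> \<in> Field \<kappa> \<Longrightarrow> (\<And>\<beta>. \<beta> \<in> underS \<kappa> \<alpha> \<Longrightarrow> P \<beta>) \<Longrightarrow> P \<alpha>"
  shows "P \<alpha>"
proof -
  have "\<alpha> \<in> Field \<kappa> \<longrightarrow> P \<alpha>"
  proof (rule wo_rel.well_order_induct[OF wo_rel, of "\<lambda>\<alpha>. \<alpha> \<in> Field \<kappa> \<longrightarrow> P \<alpha>"])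
    fix \<alpha> assume IH: "\<forall>\<beta>. \<beta> \<noteq> \<alpha> \<and> (\<beta>, \<alpha>) \<in> \<kappa> \<longrightarrow> \<beta> \<in> Field \<kappa> \<longrightarrow> P \<beta>"
    show "\<alpha> \<in> Field \<kappa> \<longrightarrow> P \<alpha>"
      using assms(2)[of \<alpha>] IH by (auto simp: underS_def Field_def)
  qed
  then show ?thesis using assms(1) by blast
qed

lemma ex_least:
  assumes "\<alpha> \<in> Field \<kappa>" and "P \<alpha>"
  obtains \<beta> where "\<beta> \<in> Field \<kappa>" "P \<beta>" "\<And>\<gamma>. \<gamma> \<in> underS \<kappa> \<beta> \<Longrightarrow> \<not> P \<gamma>"
proof -
  have "P \<alpha> \<longrightarrow> (\<exists>\<beta>\<in>Field \<kappa>. P \<beta> \<and> (\<forall>\<gamma>\<in>underS \<kappa> \<beta>. \<not> P \<gamma>))"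
    using assms(1) by (induction rule: less_induct) auto
  then show ?thesis using assms(2) that by blast
qed

lemma no_greatest:
  assumes "\<alpha> \<in> Field \<kappa>"
  obtains \<beta> where "\<beta> \<in> Field \<kappa>" "\<alpha> \<in> underS \<kappa> \<beta>"
  using infinite_Card_order_limit[OF Card_order infinite_Field assms]
  by (auto simp: underS_def)

lemma underS_small: "\<alpha> \<in> Field \<kappa> \<Longrightarrow> |underS \<kappa> \<alpha>| <o \<kappa>"
  by (rule card_of_underS[OF Card_order])

lemma small_image: "|S| <o \<kappa> \<Longrightarrow> |f ` S| <o \<kappa>"
  by (rule ordLeq_ordLess_trans[OF card_of_image])

lemma small_subset: "|S| <o \<kappa> \<Longrightarrow> T \<subseteq> S \<Longrightarrow> |T| <o \<kappa>"
  by (rule ordLeq_ordLess_trans[OF card_of_mono1])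

lemma countable_small: "|range (f :: nat \<Rightarrow> 'b)| <o \<kappa>"
  by (rule ordLeq_ordLess_trans[OF card_of_image ordIso_ordLess_trans[OF card_of_nat uncountable]])

lemma small_bounded:
  assumes "S \<subseteq> Field \<kappa>" "|S| <o \<kappa>"
  obtains \<alpha> where "\<alpha> \<in> Field \<kappa>" "S \<subseteq> underS \<kappa> \<alpha>"
proof -
  have "\<not> cofinal S \<kappa>"
    using regular assms not_ordLess_ordIso by (auto simp: regularCard_def)
  then obtain \<beta> where \<beta>: "\<beta> \<in> Field \<kappa>" "\<And>\<gamma>. \<gamma> \<in> S \<Longrightarrow> \<beta> = \<gamma> \<or> (\<beta>, \<gamma>) \<notin> \<kappa>"
    by (auto simp: cofinal_def)
  obtain \<alpha> where \<alpha>: "\<alpha> \<in> Field \<kappa>" "\<beta> \<in> underS \<kappa> \<alpha>"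
    using no_greatest \<beta>(1) by blast
  have "\<gamma> \<in> underS \<kappa> \<alpha>" if "\<gamma> \<in> S" for \<gamma>
  proof -
    have "\<beta> \<notin> underS \<kappa> \<gamma>" using \<beta>(2)[OF that] by (auto simp: underS_def)
    then have "\<gamma> = \<beta> \<or> \<gamma> \<in> underS \<kappa> \<beta>"
      using underS_linear[of \<beta> \<gamma>] \<beta>(1) that assms(1) by blast
    then show ?thesis using \<alpha> underS_trans by blast
  qed
  then show ?thesis using that \<alpha>(1) by blast
qed

lemma limit_segment_Field: "limit_segment \<kappa> (Field \<kappa>)"
proof -
  have "\<exists>\<beta>\<in>Field \<kappa>. \<alpha> \<in> underS \<kappa> \<beta>" if "\<alpha> \<in> Field \<kappa>" for \<alpha>
    using no_greatest[OF that] by blast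
  moreover have "ofilter \<kappa> (Field \<kappa>)"
    by (auto simp: ofilter_def Field_def under_def)
  ultimately show ?thesis
    unfolding limit_segment_def using Field_nonempty by blast
qed

text \<open>Removing a proper initial segment leaves a set of full size, since the removed segment
  is small and the union of two small sets is small.\<close>

lemma card_of_final_segment:
  assumes "\<alpha> \<in> Field \<kappa>"
  shows "|Field \<kappa> - underS \<kappa> \<alpha>| =o \<kappa>"
proof -
  have "\<not> |Field \<kappa> - underS \<kappa> \<alpha>| <o \<kappa>"
  proof
    assume "|Field \<kappa> - underS \<kappa> \<alpha>| <o \<kappa>"
    then have "|(Field \<kappa> - underS \<kappa> \<alpha>) \<union> underS \<kappa> \<alpha>| <o \<kappa>"
      using card_of_Un_ordLess_infinite_Field[OF infinite_Field Card_order] underS_small[OF assms]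
      by blast
    then have "|Field \<kappa>| <o \<kappa>" using small_subset[of _ "Field \<kappa>"] by blast
    then show False
      using card_of_Field_ordIso[OF Card_order] not_ordLess_ordIso by blast
  qed
  moreover have "|Field \<kappa> - underS \<kappa> \<alpha>| \<le>o \<kappa>"
    using card_of_Field_ordIso[OF Card_order] card_of_mono1[of "Field \<kappa> - underS \<kappa> \<alpha>" "Field \<kappa>"]
    by (meson Diff_subset ordLeq_ordIso_trans)
  ultimately show ?thesis
    using ordLeq_iff_ordLess_or_ordIso by blast
qed

end

section \<open>The generalized Baire space\<close>

context uncountable_regular
begin

abbreviation Baire :: "('k \<Rightarrow> 'k) topology" where
  "Baire \<equiv> generalized_Baire_space \<kappa>"

text \<open>The basic open sets, described by a point instead of a stem.\<close>

definition cylinder :: "'k \<Rightarrow> ('k \<Rightarrow> 'k) \<Rightarrow> ('k \<Rightarrow> 'k) set" where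
  "cylinder \<alpha> x = {y \<in> Field \<kappa> \<rightarrow>\<^sub>E Field \<kappa>. \<forall>\<beta>\<in>underS \<kappa> \<alpha>. y \<beta> = x \<beta>}"

lemma cylinder_self: "x \<in> Field \<kappa> \<rightarrow>\<^sub>E Field \<kappa> \<Longrightarrow> x \<in> cylinder \<alpha> x"
  by (simp add: cylinder_def)

lemma cylinder_eq: "y \<in> cylinder \<alpha> x \<Longrightarrow> cylinder \<alpha> y = cylinder \<alpha> x"
  by (auto simp: cylinder_def)

lemma cylinder_antimono: "\<alpha> \<in> underS \<kappa> \<beta> \<Longrightarrow> cylinder \<beta> x \<subseteq> cylinder \<alpha> x"
  using underS_trans by (auto simp: cylinder_def)

lemma restrict_eq_iff: "restrict y A = restrict x A \<longleftrightarrow> (\<forall>\<beta>\<in>A. y \<beta> = x \<beta>)"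
  by (metis restrict_apply' restrict_ext)

lemma Baire_generators:
  "{{x \<in> Field \<kappa> \<rightarrow>\<^sub>E Field \<kappa>. restrict x (underS \<kappa> \<alpha>) = s} | \<alpha> s.
      \<alpha> \<in> Field \<kappa> \<and> s \<in> underS \<kappa> \<alpha> \<rightarrow>\<^sub>E Field \<kappa>}
   = {cylinder \<alpha> x | \<alpha> x. \<alpha> \<in> Field \<kappa> \<and> x \<in> Field \<kappa> \<rightarrow>\<^sub>E Field \<kappa>}" (is "?L = ?R")
proof
  show "?L \<subseteq> ?R"
  proof clarify
    fix \<alpha> s assume \<alpha>: "\<alpha> \<in> Field \<kappa>" and s: "s \<in> underS \<kappa> \<alpha> \<rightarrow>\<^sub>E Field \<kappa>"
    define x where "x = (\<lambda>\<beta>. if \<beta> \<in> underS \<kappa> \<alpha> then s \<beta> else if \<beta> \<in> Field \<kappa> then \<beta> else undefined)"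
    have "x \<in> Field \<kappa> \<rightarrow>\<^sub>E Field \<kappa>"
      using s underS_FieldD(1) by (auto simp: x_def PiE_iff extensional_def)
    moreover have "restrict y (underS \<kappa> \<alpha>) = s \<longleftrightarrow> (\<forall>\<beta>\<in>underS \<kappa> \<alpha>. y \<beta> = x \<beta>)" for y
      using s by (auto simp: x_def fun_eq_iff PiE_iff extensional_def)
    then have "{x \<in> Field \<kappa> \<rightarrow>\<^sub>E Field \<kappa>. restrict x (underS \<kappa> \<alpha>) = s} = cylinder \<alpha> x"
      by (simp add: cylinder_def)
    ultimately show "\<exists>\<alpha>' x. {x \<in> Field \<kappa> \<rightarrow>\<^sub>E Field \<kappa>. restrict x (underS \<kappa> \<alpha>) = s} = cylinder \<alpha>' x
        \<and> \<alpha>' \<in> Field \<kappa> \<and> x \<in> Field \<kappa> \<rightarrow>\<^sub>E Field \<kappa>"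
      using \<alpha> by blast
  qed
  show "?R \<subseteq> ?L"
  proof clarify
    fix \<alpha> x assume \<alpha>: "\<alpha> \<in> Field \<kappa>" and x: "x \<in> Field \<kappa> \<rightarrow>\<^sub>E Field \<kappa>"
    have "restrict x (underS \<kappa> \<alpha>) \<in> underS \<kappa> \<alpha> \<rightarrow>\<^sub>E Field \<kappa>"
      using x underS_FieldD(1) by (auto simp: PiE_iff)
    moreover have "cylinder \<alpha> x
        = {y \<in> Field \<kappa> \<rightarrow>\<^sub>E Field \<kappa>. restrict y (underS \<kappa> \<alpha>) = restrict x (underS \<kappa> \<alpha>)}"
      by (simp add: cylinder_def restrict_eq_iff)
    ultimately show "\<exists>\<alpha>' s. cylinder \<alpha> x = {y \<in> Field \<kappa> \<rightarrow>\<^sub>E Field \<kappa>. restrict y (underS \<kappa> \<alpha>') = s}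
        \<and> \<alpha>' \<in> Field \<kappa> \<and> s \<in> underS \<kappa> \<alpha>' \<rightarrow>\<^sub>E Field \<kappa>"
      using \<alpha> by blast
  qed
qed

lemma openin_Baire:
  "openin Baire U \<longleftrightarrow>
     U \<subseteq> Field \<kappa> \<rightarrow>\<^sub>E Field \<kappa> \<and> (\<forall>x\<in>U. \<exists>\<alpha>\<in>Field \<kappa>. cylinder \<alpha> x \<subseteq> U)"
proof
  let ?S = "{cylinder \<alpha> x | \<alpha> x. \<alpha> \<in> Field \<kappa> \<and> x \<in> Field \<kappa> \<rightarrow>\<^sub>E Field \<kappa>}"
  assume "openin Baire U"
  then have "generate_topology_on ?S U"
    unfolding generalized_Baire_space_def Baire_generators
    by (rule openin_topology_generated_by)
  then show "U \<subseteq> Field \<kappa> \<rightarrow>\<^sub>E Field \<kappa> \<and> (\<forall>x\<in>U. \<exists>\<alpha>\<in>Field \<kappa>. cylinder \<alpha> x \<subseteq> U)"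
  proof induction
    case Empty
    then show ?case by simp
  next
    case (Int U V)
    have "\<exists>\<gamma>\<in>Field \<kappa>. cylinder \<gamma> x \<subseteq> U \<inter> V" if x: "x \<in> U \<inter> V" for x
    proof -
      obtain \<alpha> \<beta> where \<alpha>\<beta>: "\<alpha> \<in> Field \<kappa>" "\<beta> \<in> Field \<kappa>" "cylinder \<alpha> x \<subseteq> U" "cylinder \<beta> x \<subseteq> V"
        using Int x by blast
      then have "\<alpha> \<in> underS \<kappa> \<beta> \<or> \<alpha> = \<beta> \<or> \<beta> \<in> underS \<kappa> \<alpha>"
        using underS_linear by blast
      then show ?thesis
        using \<alpha>\<beta> cylinder_antimono by (metis Int_subset_iff subset_trans)
    qed
    then show ?case using Int by blast
  next
    case (UN \<U>)
    then show ?case by (meson Sup_least UnionE Union_upper subset_trans)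
  next
    case (Basis S)
    then obtain \<alpha> x where S: "S = cylinder \<alpha> x" "\<alpha> \<in> Field \<kappa>" by blast
    then have "S \<subseteq> Field \<kappa> \<rightarrow>\<^sub>E Field \<kappa>" by (auto simp: cylinder_def)
    then show ?case using S cylinder_eq by (metis order_refl)
  qed
next
  assume U: "U \<subseteq> Field \<kappa> \<rightarrow>\<^sub>E Field \<kappa> \<and> (\<forall>x\<in>U. \<exists>\<alpha>\<in>Field \<kappa>. cylinder \<alpha> x \<subseteq> U)"
  have cyl: "openin Baire (cylinder \<alpha> x)" if "\<alpha> \<in> Field \<kappa>" "x \<in> Field \<kappa> \<rightarrow>\<^sub>E Field \<kappa>" for \<alpha> x
    unfolding generalized_Baire_space_def Baire_generators
    using that by (intro topology_generated_by_Basis) blast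
  show "openin Baire U"
  proof (subst openin_subopen, intro ballI)
    fix x assume "x \<in> U"
    then obtain \<alpha> where "\<alpha> \<in> Field \<kappa>" "cylinder \<alpha> x \<subseteq> U" "x \<in> Field \<kappa> \<rightarrow>\<^sub>E Field \<kappa>"
      using U by blast
    then show "\<exists>T. openin Baire T \<and> x \<in> T \<and> T \<subseteq> U"
      using cylinder_self[of x \<alpha>] cyl by blast
  qed
qed

lemma topspace_Baire: "topspace Baire = Field \<kappa> \<rightarrow>\<^sub>E Field \<kappa>"
proof
  show "topspace Baire \<subseteq> Field \<kappa> \<rightarrow>\<^sub>E Field \<kappa>"
    using openin_topspace[of Baire] unfolding openin_Baire by simp
  have "openin Baire (Field \<kappa> \<rightarrow>\<^sub>E Field \<kappa>)"
    unfolding openin_Baire using Field_nonempty by (auto simp: cylinder_def)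
  then show "Field \<kappa> \<rightarrow>\<^sub>E Field \<kappa> \<subseteq> topspace Baire"
    using openin_subset by blast
qed

lemma cylinder_subset: "cylinder \<alpha> x \<subseteq> Field \<kappa> \<rightarrow>\<^sub>E Field \<kappa>"
  by (auto simp: cylinder_def)

lemma openin_cylinder: "\<alpha> \<in> Field \<kappa> \<Longrightarrow> openin Baire (cylinder \<alpha> x)"
  unfolding openin_Baire using cylinder_subset cylinder_eq by blast

lemma closedin_cylinder:
  assumes "\<alpha> \<in> Field \<kappa>"
  shows "closedin Baire (cylinder \<alpha> x)"
proof -
  have "openin Baire (topspace Baire - cylinder \<alpha> x)"
    unfolding openin_Baire
  proof (intro conjI ballI)
    fix y assume "y \<in> topspace Baire - cylinder \<alpha> x"
    then have "cylinder \<alpha> y \<subseteq> topspace Baire - cylinder \<alpha> x"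
      by (auto simp: topspace_Baire cylinder_def)
    then show "\<exists>\<beta>\<in>Field \<kappa>. cylinder \<beta> y \<subseteq> topspace Baire - cylinder \<alpha> x"
      using assms by blast
  qed (auto simp: topspace_Baire)
  then show ?thesis
    using cylinder_subset[of \<alpha> x] by (simp add: closedin_def topspace_Baire)
qed

lemma kappa_additive_Baire: "kappa_additive \<kappa> Baire"
  unfolding kappa_additive_def
proof (intro allI impI)
  fix \<U> assume \<U>: "(\<forall>U\<in>\<U>. openin Baire U) \<and> |\<U>| <o \<kappa>"
  show "openin Baire (topspace Baire \<inter> \<Inter>\<U>)"
    unfolding openin_Baire
  proof (intro conjI ballI)
    show "topspace Baire \<inter> \<Inter>\<U> \<subseteq> Field \<kappa> \<rightarrow>\<^sub>E Field \<kappa>"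
      by (auto simp: topspace_Baire)
  next
    fix x assume x: "x \<in> topspace Baire \<inter> \<Inter>\<U>"
    then have "\<forall>U\<in>\<U>. \<exists>\<alpha>. \<alpha> \<in> Field \<kappa> \<and> cylinder \<alpha> x \<subseteq> U"
      using \<U> unfolding openin_Baire by blast
    then obtain a where a: "\<And>U. U \<in> \<U> \<Longrightarrow> a U \<in> Field \<kappa> \<and> cylinder (a U) x \<subseteq> U"
      by metis
    have "|a ` \<U>| <o \<kappa>" using small_image \<U> by blast
    then obtain \<alpha> where \<alpha>: "\<alpha> \<in> Field \<kappa>" "a ` \<U> \<subseteq> underS \<kappa> \<alpha>"
      using a by (metis small_bounded image_subsetI)
    have "cylinder \<alpha> x \<subseteq> U" if "U \<in> \<U>" for U
      using a[OF that] \<alpha>(2) that cylinder_antimono[of "a U" \<alpha> x] by blast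
    moreover have "cylinder \<alpha> x \<subseteq> topspace Baire"
      using cylinder_subset by (simp add: topspace_Baire)
    ultimately show "\<exists>\<alpha>\<in>Field \<kappa>. cylinder \<alpha> x \<subseteq> topspace Baire \<inter> \<Inter>\<U>"
      using \<alpha>(1) by blast
  qed
qed

lemma regular_space_Baire: "regular_space Baire"
  unfolding neighbourhood_base_of_closedin[symmetric] neighbourhood_base_of
proof (intro allI impI)
  fix W x assume W: "openin Baire W \<and> x \<in> W"
  then obtain \<alpha> where "\<alpha> \<in> Field \<kappa>" "cylinder \<alpha> x \<subseteq> W" "x \<in> Field \<kappa> \<rightarrow>\<^sub>E Field \<kappa>"
    unfolding openin_Baire by blast
  then show "\<exists>U V. openin Baire U \<and> closedin Baire V \<and> x \<in> U \<and> U \<subseteq> V \<and> V \<subseteq> W"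
    using openin_cylinder closedin_cylinder cylinder_self
    by (intro exI[of _ "cylinder \<alpha> x"]) auto
qed

lemma Hausdorff_space_Baire: "Hausdorff_space Baire"
  unfolding Hausdorff_space_def topspace_Baire
proof (intro allI impI)
  fix x y :: "'k \<Rightarrow> 'k"
  assume xy: "x \<in> Field \<kappa> \<rightarrow>\<^sub>E Field \<kappa> \<and> y \<in> Field \<kappa> \<rightarrow>\<^sub>E Field \<kappa> \<and> x \<noteq> y"
  then obtain \<beta> where \<beta>: "\<beta> \<in> Field \<kappa>" "x \<beta> \<noteq> y \<beta>"
    by (meson PiE_ext)
  obtain \<alpha> where "\<alpha> \<in> Field \<kappa>" "\<beta> \<in> underS \<kappa> \<alpha>"
    using no_greatest \<beta>(1) by blast
  then show "\<exists>U V. openin Baire U \<and> openin Baire V \<and> x \<in> U \<and> y \<in> V \<and> disjnt U V"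
    using openin_cylinder[of \<alpha>] cylinder_self xy \<beta>
    by (intro exI[of _ "cylinder \<alpha> x"] exI[of _ "cylinder \<alpha> y"])
       (auto simp: disjnt_iff cylinder_def)
qed

text \<open>By regularity every sequence of length \<open>\<alpha> < \<kappa>\<close> in \<open>\<kappa>\<close> is bounded, so its graph is a subset of
  \<open>\<alpha> \<times> \<beta>\<close> for some \<open>\<beta> < \<kappa>\<close>. This is how \<open>2\<^bsup><\<kappa>\<^esup> = \<kappa>\<close> gives \<open>\<kappa>\<^bsup><\<kappa>\<^esup> = \<kappa>\<close>.\<close>

lemma card_of_short_sequences:
  assumes two: "two_power_less \<kappa> =o \<kappa>" and \<alpha>: "\<alpha> \<in> Field \<kappa>"
  shows "|underS \<kappa> \<alpha> \<rightarrow>\<^sub>E Field \<kappa>| \<le>o \<kappa>"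
proof -
  have Pow_small: "|Pow S| \<le>o \<kappa>" if S: "|S| <o \<kappa>" for S :: "('k \<times> 'k) set"
  proof -
    obtain \<gamma> where \<gamma>: "\<gamma> \<in> Field \<kappa>" "|S| =o Restr \<kappa> (underS \<kappa> \<gamma>)"
      using S ordLess_iff_ordIso_Restr[OF Well_order, of "|S|"] card_of_Well_order by blast
    have "Field (Restr \<kappa> (underS \<kappa> \<gamma>)) = underS \<kappa> \<gamma>"
      using Field_Restr_ofilter[OF Well_order] wo_rel.underS_ofilter[OF wo_rel] by blast
    then have "|S| =o |underS \<kappa> \<gamma>|"
      using card_of_cong[OF \<gamma>(2)] Field_card_of by metis
    then obtain f where f: "bij_betw f S (underS \<kappa> \<gamma>)"
      using card_of_ordIso by blast
    have "|Pow S| \<le>o |Pow (underS \<kappa> \<gamma>)|"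
      using bij_betw_Pow[OF f] card_of_ordIso ordIso_imp_ordLeq by blast
    moreover have "|Pow (underS \<kappa> \<gamma>)| \<le>o ctwo ^c |underS \<kappa> \<gamma>|"
      unfolding ctwo_def cexp_def Field_card_of
      by (rule ordIso_imp_ordLeq[OF card_of_Pow_Func])
    moreover have "ctwo ^c |underS \<kappa> \<gamma>| \<le>o two_power_less \<kappa>"
    proof -
      let ?c = "\<lambda>\<gamma>. ctwo ^c |underS \<kappa> \<gamma>|"
      have "ctwo ^c |underS \<kappa> \<gamma>| \<le>o |Field (?c \<gamma>)|"
        by (rule ordIso_imp_ordLeq[OF ordIso_symmetric[OF card_of_Field_ordIso[OF Card_order_cexp]]])
      moreover have "|Field (?c \<gamma>)| \<le>o |SIGMA \<gamma> : Field \<kappa>. Field (?c \<gamma>)|"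
        using \<gamma>(1) by (intro surj_imp_ordLeq[where f = snd] subsetI image_eqI[of _ _ "(\<gamma>, _)"]) auto
      ultimately show ?thesis
        unfolding two_power_less_def Csum_def by (rule ordLeq_transitive)
    qed
    ultimately show ?thesis
      using two by (meson ordLeq_ordIso_trans ordLeq_transitive)
  qed
  have bounded_sequences: "|underS \<kappa> \<alpha> \<rightarrow>\<^sub>E underS \<kappa> \<beta>| \<le>o \<kappa>" if \<beta>: "\<beta> \<in> Field \<kappa>" for \<beta>
  proof -
    define graph where "graph s = (\<lambda>\<xi>. (\<xi>, s \<xi> :: 'k)) ` underS \<kappa> \<alpha>" for s
    have "inj_on graph (underS \<kappa> \<alpha> \<rightarrow>\<^sub>E underS \<kappa> \<beta>)"
    proof (rule inj_onI)
      fix s t assume st: "s \<in> underS \<kappa> \<alpha> \<rightarrow>\<^sub>E underS \<kappa> \<beta>" "t \<in> underS \<kappa> \<alpha> \<rightarrow>\<^sub>E underS \<kappa> \<beta>"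
        and eq: "graph s = graph t"
      have "s \<xi> = t \<xi>" if "\<xi> \<in> underS \<kappa> \<alpha>" for \<xi>
        using eq that by (auto simp: graph_def)
      then show "s = t" using st by (rule_tac PiE_ext) auto
    qed
    moreover have "graph ` (underS \<kappa> \<alpha> \<rightarrow>\<^sub>E underS \<kappa> \<beta>) \<subseteq> Pow (underS \<kappa> \<alpha> \<times> underS \<kappa> \<beta>)"
      by (auto simp: graph_def PiE_iff)
    ultimately have "|underS \<kappa> \<alpha> \<rightarrow>\<^sub>E underS \<kappa> \<beta>| \<le>o |Pow (underS \<kappa> \<alpha> \<times> underS \<kappa> \<beta>)|"
      using card_of_ordLeq by blast
    moreover have "|underS \<kappa> \<alpha> \<times> underS \<kappa> \<beta>| <o \<kappa>"
      using stable underS_small[OF \<alpha>] underS_small[OF \<beta>] by (intro stable_elim) auto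
    ultimately show ?thesis
      using Pow_small ordLeq_transitive by blast
  qed
  have "(underS \<kappa> \<alpha> \<rightarrow>\<^sub>E Field \<kappa>) \<subseteq> (\<Union>\<beta>\<in>Field \<kappa>. underS \<kappa> \<alpha> \<rightarrow>\<^sub>E underS \<kappa> \<beta>)"
  proof
    fix s assume s: "s \<in> underS \<kappa> \<alpha> \<rightarrow>\<^sub>E Field \<kappa>"
    then have "s ` underS \<kappa> \<alpha> \<subseteq> Field \<kappa>" by (auto simp: PiE_iff)
    moreover have "|s ` underS \<kappa> \<alpha>| <o \<kappa>" using small_image underS_small[OF \<alpha>] .
    ultimately obtain \<beta> where "\<beta> \<in> Field \<kappa>" "s ` underS \<kappa> \<alpha> \<subseteq> underS \<kappa> \<beta>"
      using small_bounded by blast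
    then show "s \<in> (\<Union>\<beta>\<in>Field \<kappa>. underS \<kappa> \<alpha> \<rightarrow>\<^sub>E underS \<kappa> \<beta>)"
      using s by (auto simp: PiE_iff)
  qed
  moreover have "|\<Union>\<beta>\<in>Field \<kappa>. underS \<kappa> \<alpha> \<rightarrow>\<^sub>E underS \<kappa> \<beta>| \<le>o \<kappa>"
    using bounded_sequences ordIso_imp_ordLeq[OF card_of_Field_ordIso[OF Card_order]]
    by (intro card_of_UNION_ordLeq_infinite_Field[OF infinite_Field Card_order]) auto
  ultimately show ?thesis
    by (meson card_of_mono1 ordLeq_transitive)
qed

lemma weight_le_Baire:
  assumes "two_power_less \<kappa> =o \<kappa>"
  shows "weight_le \<kappa> Baire"
proof -
  let ?I = "SIGMA \<alpha> : Field \<kappa>. underS \<kappa> \<alpha> \<rightarrow>\<^sub>E Field \<kappa>"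
  define \<B> where "\<B> = (\<lambda>(\<alpha>, s). cylinder \<alpha> s) ` ?I"
  have "|?I| \<le>o \<kappa>"
    using card_of_short_sequences[OF assms]
      ordIso_imp_ordLeq[OF card_of_Field_ordIso[OF Card_order]]
    by (intro card_of_Sigma_ordLeq_infinite_Field[OF infinite_Field Card_order]) auto
  then have "|\<B>| \<le>o \<kappa>"
    unfolding \<B>_def by (rule ordLeq_transitive[OF card_of_image])
  moreover have "\<forall>V\<in>\<B>. openin Baire V"
    using openin_cylinder by (auto simp: \<B>_def)
  moreover have "\<exists>V\<in>\<B>. x \<in> V \<and> V \<subseteq> U" if Ux: "openin Baire U" "x \<in> U" for U x
  proof -
    obtain \<alpha> where \<alpha>: "\<alpha> \<in> Field \<kappa>" "cylinder \<alpha> x \<subseteq> U" and x: "x \<in> Field \<kappa> \<rightarrow>\<^sub>E Field \<kappa>"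
      using Ux unfolding openin_Baire by blast
    have "cylinder \<alpha> x = cylinder \<alpha> (restrict x (underS \<kappa> \<alpha>))"
      by (auto simp: cylinder_def)
    moreover have "restrict x (underS \<kappa> \<alpha>) \<in> underS \<kappa> \<alpha> \<rightarrow>\<^sub>E Field \<kappa>"
      using x underS_FieldD(1) by (auto simp: PiE_iff)
    ultimately have "cylinder \<alpha> x \<in> \<B>"
      using \<alpha>(1) by (force simp: \<B>_def intro: rev_image_eqI)
    then show ?thesis
      using \<alpha>(2) cylinder_self[OF x] by (intro bexI[of _ "cylinder \<alpha> x"]) simp_all
  qed
  ultimately show ?thesis
    unfolding weight_le_def by blast
qed

text \<open>A \<open>\<kappa>\<close>-additive space makes the remaining set of the game open in every round, so that
  relatively open moves are open.\<close>

lemma openin_choquet_remaining: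
  assumes "kappa_additive \<kappa> X" "\<alpha> \<in> Field \<kappa>" "\<And>\<beta>. \<beta> \<in> underS \<kappa> \<alpha> \<Longrightarrow> openin X (V \<beta>)"
  shows "openin X (choquet_remaining \<kappa> X V \<alpha>)"
proof -
  have "|V ` underS \<kappa> \<alpha>| <o \<kappa>"
    using small_image underS_small assms(2) by blast
  then have "openin X (topspace X \<inter> \<Inter>(V ` underS \<kappa> \<alpha>))"
    using assms(1,3) unfolding kappa_additive_def by blast
  then show ?thesis by (simp add: choquet_remaining_def)
qed

text \<open>II answers \<open>(U, x)\<close> with a cylinder around \<open>x\<close> inside \<open>U\<close>. The cylinders played form a
  decreasing chain, hence their stems are compatible and have a common extension.\<close>

lemma choquet_winning_Baire:
  obtains \<sigma> where "choquet_winning_II \<kappa> Baire \<sigma>"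
proof -
  define len where "len U x = (SOME \<alpha>. \<alpha> \<in> Field \<kappa> \<and> cylinder \<alpha> x \<subseteq> U)" for U x
  have len: "len U x \<in> Field \<kappa> \<and> cylinder (len U x) x \<subseteq> U" if "openin Baire U" "x \<in> U" for U x
    unfolding len_def using that someI_ex[of "\<lambda>\<alpha>. \<alpha> \<in> Field \<kappa> \<and> cylinder \<alpha> x \<subseteq> U"]
    unfolding openin_Baire by blast
  define \<sigma> :: "('k, 'k \<Rightarrow> 'k) choquet_strategy" where
    "\<sigma> = (\<lambda>\<alpha> U x V. cylinder (len (U \<alpha>) (x \<alpha>)) (x \<alpha>))"
  have "choquet_winning_II \<kappa> Baire \<sigma>"
    unfolding choquet_winning_II_def
  proof (intro allI impI)
    fix D U x V
    assume "ofilter \<kappa> D \<and>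
      (\<forall>\<alpha>\<in>D. choquet_legal_I \<kappa> Baire U x V \<alpha> \<and> choquet_follows \<kappa> \<sigma> U x V \<alpha>)"
    then have D: "D \<subseteq> Field \<kappa>" "\<And>\<alpha> \<beta>. \<alpha> \<in> D \<Longrightarrow> \<beta> \<in> underS \<kappa> \<alpha> \<Longrightarrow> \<beta> \<in> D"
      and legal: "\<And>\<alpha>. \<alpha> \<in> D \<Longrightarrow> choquet_legal_I \<kappa> Baire U x V \<alpha>"
      and follows: "\<And>\<alpha>. \<alpha> \<in> D \<Longrightarrow> choquet_follows \<kappa> \<sigma> U x V \<alpha>"
      by (auto simp: ofilter_def under_def underS_def)
    have V: "V \<alpha> = cylinder (len (U \<alpha>) (x \<alpha>)) (x \<alpha>)" if "\<alpha> \<in> D" for \<alpha>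
      using follows[OF that] D(1) that under_eq[of \<alpha>]
      by (auto simp: choquet_follows_def \<sigma>_def)
    have move: "openin Baire (U \<alpha>) \<and> U \<alpha> \<subseteq> choquet_remaining \<kappa> Baire V \<alpha> \<and> x \<alpha> \<in> U \<alpha> \<and>
        len (U \<alpha>) (x \<alpha>) \<in> Field \<kappa> \<and> openin Baire (V \<alpha>) \<and> V \<alpha> \<subseteq> U \<alpha>" if "\<alpha> \<in> D" for \<alpha>
    proof -
      have "\<alpha> \<in> Field \<kappa>" using that D(1) by blast
      then have "\<alpha> \<in> D \<longrightarrow> ?thesis"
      proof (induction rule: less_induct)
        case (less \<alpha>)
        show ?case
        proof
          assume \<alpha>: "\<alpha> \<in> D"
          then have "openin Baire (choquet_remaining \<kappa> Baire V \<alpha>)"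
            using less D(2) by (intro openin_choquet_remaining[OF kappa_additive_Baire]) auto
          moreover have U: "openin (subtopology Baire (choquet_remaining \<kappa> Baire V \<alpha>)) (U \<alpha>)"
              "x \<alpha> \<in> U \<alpha>"
            using legal[OF \<alpha>] by (auto simp: choquet_legal_I_def)
          ultimately have "openin Baire (U \<alpha>) \<and> U \<alpha> \<subseteq> choquet_remaining \<kappa> Baire V \<alpha>"
            using openin_open_subtopology by blast
          then show "openin Baire (U \<alpha>) \<and> U \<alpha> \<subseteq> choquet_remaining \<kappa> Baire V \<alpha> \<and> x \<alpha> \<in> U \<alpha> \<and>
              len (U \<alpha>) (x \<alpha>) \<in> Field \<kappa> \<and> openin Baire (V \<alpha>) \<and> V \<alpha> \<subseteq> U \<alpha>"
            using U(2) len V[OF \<alpha>] openin_cylinder by simp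
        qed
      qed
      then show ?thesis using that by blast
    qed
    have x: "x \<alpha> \<in> Field \<kappa> \<rightarrow>\<^sub>E Field \<kappa>" if "\<alpha> \<in> D" for \<alpha>
      using move[OF that] unfolding openin_Baire by blast
    then have xV: "x \<alpha> \<in> V \<alpha>" if "\<alpha> \<in> D" for \<alpha>
      using V[OF that] that cylinder_self by simp
    have chain: "V \<alpha> \<subseteq> V \<beta>" if "\<alpha> \<in> D" "\<beta> \<in> underS \<kappa> \<alpha>" for \<alpha> \<beta>
      using move[OF that(1)] that(2) by (auto simp: choquet_remaining_def)
    have "choquet_legal_II \<kappa> Baire U x V \<alpha>" if "\<alpha> \<in> D" for \<alpha>
    proof -
      have "V \<alpha> = V \<alpha> \<inter> choquet_remaining \<kappa> Baire V \<alpha>"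
        using move[OF that] by blast
      then have "openin (subtopology Baire (choquet_remaining \<kappa> Baire V \<alpha>)) (V \<alpha>)"
        using move[OF that] unfolding openin_subtopology by blast
      then show ?thesis
        using move[OF that] xV[OF that] by (simp add: choquet_legal_II_def)
    qed
    moreover have "(\<Inter>\<alpha>\<in>D. V \<alpha>) \<noteq> {}" if nonempty: "D \<noteq> {}"
    proof -
      define stem where "stem \<alpha> = underS \<kappa> (len (U \<alpha>) (x \<alpha>))" for \<alpha>
      have V_iff: "y \<in> V \<alpha> \<longleftrightarrow> y \<in> Field \<kappa> \<rightarrow>\<^sub>E Field \<kappa> \<and> (\<forall>\<xi>\<in>stem \<alpha>. y \<xi> = x \<alpha> \<xi>)"
        if "\<alpha> \<in> D" for \<alpha> y
        using V[OF that] by (simp add: cylinder_def stem_def)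
      have agree: "x \<alpha> \<xi> = x \<beta> \<xi>"
        if "\<alpha> \<in> D" "\<beta> \<in> D" "\<xi> \<in> stem \<alpha>" "\<xi> \<in> stem \<beta>" for \<alpha> \<beta> \<xi>
      proof -
        have "\<alpha> \<in> underS \<kappa> \<beta> \<or> \<alpha> = \<beta> \<or> \<beta> \<in> underS \<kappa> \<alpha>"
          using underS_linear that D(1) by blast
        then show ?thesis
        proof (elim disjE)
          assume "\<alpha> \<in> underS \<kappa> \<beta>"
          then have "x \<beta> \<in> V \<alpha>" using chain xV that by blast
          then show ?thesis using V_iff[OF that(1)] that(3) by simp
        next
          assume "\<beta> \<in> underS \<kappa> \<alpha>"
          then have "x \<alpha> \<in> V \<beta>" using chain xV that by blast
          then show ?thesis using V_iff[OF that(2)] that(4) by simp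
        qed simp
      qed
      obtain \<delta> where \<delta>: "\<delta> \<in> D" using nonempty by blast
      define y where "y \<xi> = (if \<exists>\<alpha>\<in>D. \<xi> \<in> stem \<alpha> then x (SOME \<alpha>. \<alpha> \<in> D \<and> \<xi> \<in> stem \<alpha>) \<xi> else x \<delta> \<xi>)"
        for \<xi>
      have y_cases: "\<exists>\<alpha>\<in>D. y \<xi> = x \<alpha> \<xi>" for \<xi>
        unfolding y_def using \<delta> someI_ex[of "\<lambda>\<alpha>. \<alpha> \<in> D \<and> \<xi> \<in> stem \<alpha>"] by auto
      have y_stem: "y \<xi> = x \<alpha> \<xi>" if "\<alpha> \<in> D" "\<xi> \<in> stem \<alpha>" for \<alpha> \<xi>
      proof -
        define \<alpha>' where "\<alpha>' = (SOME \<alpha>. \<alpha> \<in> D \<and> \<xi> \<in> stem \<alpha>)"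
        have "\<alpha>' \<in> D \<and> \<xi> \<in> stem \<alpha>'"
          unfolding \<alpha>'_def using that by (intro someI_ex[of "\<lambda>\<alpha>. \<alpha> \<in> D \<and> \<xi> \<in> stem \<alpha>"]) blast
        moreover have "y \<xi> = x \<alpha>' \<xi>"
          unfolding y_def \<alpha>'_def using that by auto
        ultimately show ?thesis using agree[of \<alpha>' \<alpha> \<xi>] that by simp
      qed
      have "y \<in> Field \<kappa> \<rightarrow>\<^sub>E Field \<kappa>"
      proof (rule PiE_I)
        fix \<xi>
        obtain \<alpha> where \<alpha>: "\<alpha> \<in> D" "y \<xi> = x \<alpha> \<xi>" using y_cases by blast
        show "y \<xi> \<in> Field \<kappa>" if "\<xi> \<in> Field \<kappa>" using x[OF \<alpha>(1)] \<alpha>(2) that by auto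
        show "y \<xi> = undefined" if "\<xi> \<notin> Field \<kappa>"
          using x[OF \<alpha>(1)] \<alpha>(2) that by (auto simp: PiE_iff extensional_def)
      qed
      then have "y \<in> (\<Inter>\<alpha>\<in>D. V \<alpha>)"
        using V_iff y_stem by blast
      then show ?thesis by blast
    qed
    ultimately show "(\<forall>\<alpha>\<in>D. choquet_legal_II \<kappa> Baire U x V \<alpha>) \<and>
        (limit_segment \<kappa> D \<longrightarrow> (\<Inter>\<alpha>\<in>D. V \<alpha>) \<noteq> {})"
      by (auto simp: limit_segment_def)
  qed
  then show ?thesis using that by blast
qed

lemma SC_space_Baire:
  assumes "two_power_less \<kappa> =o \<kappa>"
  shows "SC_space \<kappa> Baire"
  unfolding SC_space_def
  using regular_space_Baire Hausdorff_space_Baire weight_le_Baire[OF assms] choquet_winning_Baire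
  by metis

text \<open>The sets on which the \<open>\<beta>\<close>-th coordinate is constant are relatively open and cover \<open>L\<close>, so
  fewer than \<open>\<kappa>\<close> of them suffice, and each contributes only one value.\<close>

lemma Lindelof_coordinate_small:
  assumes L: "kappa_Lindelof_in \<kappa> Baire L" and \<beta>: "\<beta> \<in> Field \<kappa>"
  shows "|(\<lambda>x. x \<beta>) ` L| <o \<kappa>"
proof -
  define \<U> where "\<U> = (\<lambda>i. {x \<in> L. x \<beta> = i}) ` Field \<kappa>"
  have L_sub: "L \<subseteq> Field \<kappa> \<rightarrow>\<^sub>E Field \<kappa>"
    and Lind: "kappa_Lindelof_space \<kappa> (subtopology Baire L)"
    using L by (auto simp: kappa_Lindelof_in_def topspace_Baire)
  have top: "topspace (subtopology Baire L) = L"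
    using L_sub by (auto simp: topspace_Baire)
  obtain \<alpha> where \<alpha>: "\<alpha> \<in> Field \<kappa>" "\<beta> \<in> underS \<kappa> \<alpha>"
    using no_greatest \<beta> by blast
  have "openin (subtopology Baire L) {x \<in> L. x \<beta> = i}" for i
  proof -
    have "openin Baire {x \<in> Field \<kappa> \<rightarrow>\<^sub>E Field \<kappa>. x \<beta> = i}"
      unfolding openin_Baire
    proof (intro conjI ballI)
      fix x assume "x \<in> {x \<in> Field \<kappa> \<rightarrow>\<^sub>E Field \<kappa>. x \<beta> = i}"
      then have "cylinder \<alpha> x \<subseteq> {x \<in> Field \<kappa> \<rightarrow>\<^sub>E Field \<kappa>. x \<beta> = i}"
        using \<alpha>(2) by (auto simp: cylinder_def)
      then show "\<exists>\<alpha>\<in>Field \<kappa>. cylinder \<alpha> x \<subseteq> {x \<in> Field \<kappa> \<rightarrow>\<^sub>E Field \<kappa>. x \<beta> = i}"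
        using \<alpha>(1) by blast
    qed auto
    moreover have "{x \<in> L. x \<beta> = i} = {x \<in> Field \<kappa> \<rightarrow>\<^sub>E Field \<kappa>. x \<beta> = i} \<inter> L"
      using L_sub by blast
    ultimately show ?thesis
      unfolding openin_subtopology by blast
  qed
  then have "\<forall>U\<in>\<U>. openin (subtopology Baire L) U"
    by (simp add: \<U>_def)
  moreover have "\<Union>\<U> = L"
    using L_sub \<beta> unfolding \<U>_def by (fastforce simp: PiE_iff)
  ultimately have "\<exists>\<V>. |\<V>| <o \<kappa> \<and> \<V> \<subseteq> \<U> \<and> \<Union>\<V> = L"
    by (rule Lind[unfolded kappa_Lindelof_space_def top, rule_format, OF conjI])
  then obtain \<V> where \<V>: "|\<V>| <o \<kappa>" "\<V> \<subseteq> \<U>" "\<Union>\<V> = L"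
    by (elim exE conjE)
  have "(\<lambda>x. x \<beta>) ` L \<subseteq> (\<lambda>S. (SOME x. x \<in> S) \<beta>) ` \<V>"
  proof clarify
    fix x assume "x \<in> L"
    then obtain S where S: "S \<in> \<V>" "x \<in> S" using \<V>(3) by blast
    have "(SOME x. x \<in> S) \<in> S" using S(2) some_in_eq[of S] by auto
    with S have "x \<beta> = (SOME x. x \<in> S) \<beta>" using \<V>(2) by (auto simp: \<U>_def)
    then show "x \<beta> \<in> (\<lambda>S. (SOME x. x \<in> S) \<beta>) ` \<V>" using S(1) by (rule image_eqI)
  qed
  then show ?thesis
    using small_subset[OF small_image[OF \<V>(1)]] by blast
qed

text \<open>Diagonalization: a sequence extending a given stem can avoid the \<open>\<alpha>\<close>-th \<open>\<kappa>\<close>-Lindelof set at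
  a coordinate reserved for \<open>\<alpha>\<close>, because that set takes fewer than \<open>\<kappa>\<close> values there.\<close>

lemma K_kappa_sets_empty_interior_Baire: "K_kappa_sets_empty_interior \<kappa> Baire"
  unfolding K_kappa_sets_empty_interior_def
proof (intro allI impI, rule ccontr)
  fix K assume "K_kappa_in \<kappa> Baire K" and "Baire interior_of K \<noteq> {}"
  then obtain L x where L: "\<And>\<alpha>. \<alpha> \<in> Field \<kappa> \<Longrightarrow> kappa_Lindelof_in \<kappa> Baire (L \<alpha>)"
    and K: "K = (\<Union>\<alpha>\<in>Field \<kappa>. L \<alpha>)" and x: "x \<in> Baire interior_of K"
    unfolding K_kappa_in_def by blast
  obtain \<alpha> where \<alpha>: "\<alpha> \<in> Field \<kappa>" "cylinder \<alpha> x \<subseteq> Baire interior_of K"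
    and x_Baire: "x \<in> Field \<kappa> \<rightarrow>\<^sub>E Field \<kappa>"
    using x openin_interior_of[of Baire K] unfolding openin_Baire by blast
  obtain r where r: "bij_betw r (Field \<kappa> - underS \<kappa> \<alpha>) (Field \<kappa>)"
    using card_of_final_segment[OF \<alpha>(1)] card_of_Field_ordIso[OF Card_order]
    by (metis card_of_ordIso ordIso_symmetric ordIso_transitive)
  have "\<exists>i\<in>Field \<kappa>. i \<notin> (\<lambda>z. z \<beta>) ` L (r \<beta>)" if \<beta>: "\<beta> \<in> Field \<kappa> - underS \<kappa> \<alpha>" for \<beta>
  proof (rule ccontr)
    assume "\<not> ?thesis"
    then have "Field \<kappa> \<subseteq> (\<lambda>z. z \<beta>) ` L (r \<beta>)" by blast
    moreover have "r \<beta> \<in> Field \<kappa>" using r \<beta> by (auto simp: bij_betw_def)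
    ultimately have "|Field \<kappa>| <o \<kappa>"
      using Lindelof_coordinate_small[OF L] \<beta> small_subset by blast
    then show False
      using card_of_Field_ordIso[OF Card_order] not_ordLess_ordIso by blast
  qed
  then obtain e where e: "\<And>\<beta>. \<beta> \<in> Field \<kappa> - underS \<kappa> \<alpha> \<Longrightarrow>
      e \<beta> \<in> Field \<kappa> \<and> e \<beta> \<notin> (\<lambda>z. z \<beta>) ` L (r \<beta>)"
    by metis
  \<comment> \<open>Coordinate \<open>\<beta>\<close> is reserved for the set \<open>L (r \<beta>)\<close>, and \<open>r\<close> is onto.\<close>
  define y where "y \<beta> = (if \<beta> \<in> Field \<kappa> - underS \<kappa> \<alpha> then e \<beta> else x \<beta>)" for \<beta>
  have "y \<in> cylinder \<alpha> x"
    using x_Baire e by (auto simp: cylinder_def y_def PiE_iff extensional_def)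
  then have "y \<in> K" using \<alpha>(2) interior_of_subset[of Baire K] by blast
  then obtain \<gamma> where \<gamma>: "\<gamma> \<in> Field \<kappa>" "y \<in> L \<gamma>" using K by blast
  then obtain \<beta> where \<beta>: "\<beta> \<in> Field \<kappa> - underS \<kappa> \<alpha>" "r \<beta> = \<gamma>"
    using r by (metis bij_betw_imp_surj_on imageE)
  have "e \<beta> = y \<beta>" using \<beta>(1) by (simp add: y_def)
  then have "e \<beta> \<in> (\<lambda>z. z \<beta>) ` L (r \<beta>)"
    using \<gamma>(2) \<beta>(2) by (intro image_eqI[of _ _ y]) simp_all
  then show False using e[OF \<beta>(1)] by simp
qed

lemma Lindelof_sets_empty_interior_if_K_kappa:
  assumes "K_kappa_sets_empty_interior \<kappa> X"
  shows "Lindelof_sets_empty_interior \<kappa> X"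
proof -
  have "K_kappa_in \<kappa> X L" if "kappa_Lindelof_in \<kappa> X L" for L
    unfolding K_kappa_in_def using that Field_nonempty by (intro exI[of _ "\<lambda>_. L"]) auto
  then show ?thesis
    using assms unfolding K_kappa_sets_empty_interior_def Lindelof_sets_empty_interior_def by simp
qed

end

section \<open>Partitions of open sets of additive spaces\<close>

context uncountable_regular
begin

lemma additive_Inter:
  assumes "kappa_additive \<kappa> X" "|I| <o \<kappa>" "\<And>i. i \<in> I \<Longrightarrow> openin X (S i)"
  shows "openin X (topspace X \<inter> (\<Inter>i\<in>I. S i))"
  using assms small_image[OF assms(2), of S] unfolding kappa_additive_def by simp

lemma additive_Union_closedin:
  assumes "kappa_additive \<kappa> X" "|I| <o \<kappa>" "\<And>i. i \<in> I \<Longrightarrow> closedin X (S i)"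
  shows "closedin X (\<Union>i\<in>I. S i)"
proof -
  have "openin X (topspace X \<inter> (\<Inter>i\<in>I. topspace X - S i))"
    using assms by (intro additive_Inter) (auto simp: closedin_def)
  moreover have "topspace X \<inter> (\<Inter>i\<in>I. topspace X - S i) = topspace X - (\<Union>i\<in>I. S i)"
    by auto
  moreover have "(\<Union>i\<in>I. S i) \<subseteq> topspace X"
    using assms(3) closedin_subset by blast
  ultimately show ?thesis
    by (simp add: closedin_def)
qed

text \<open>This is where uncountability enters: in a regular space one can interpolate
  open and closed neighbourhoods alternately, and the intersection of the resulting sequence is both
  open, being a countable intersection, and closed.\<close>

lemma ex_clopen_neighbourhood:
  assumes add: "kappa_additive \<kappa> X" and reg: "regular_space X"
    and U: "openin X U" "x \<in> U"
  obtains K where "openin X K" "closedin X K" "x \<in> K" "K \<subseteq> U"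
proof -
  have nested: "\<exists>W' F. openin X W' \<and> closedin X F \<and> x \<in> W' \<and> W' \<subseteq> F \<and> F \<subseteq> W"
    if "openin X W" "x \<in> W" for W
    using reg that unfolding neighbourhood_base_of_closedin[symmetric] neighbourhood_base_of
    by simp
  have "\<exists>f. \<forall>n :: nat. (openin X (f n) \<and> x \<in> f n \<and> f n \<subseteq> U) \<and>
      (\<exists>F. closedin X F \<and> f (Suc n) \<subseteq> F \<and> F \<subseteq> f n)"
  proof (rule dependent_nat_choice)
    show "\<exists>W. openin X W \<and> x \<in> W \<and> W \<subseteq> U" using U by blast
  next
    fix W and n :: nat
    assume W: "openin X W \<and> x \<in> W \<and> W \<subseteq> U"
    then obtain W' F where "openin X W'" "closedin X F" "x \<in> W'" "W' \<subseteq> F" "F \<subseteq> W"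
      using nested[of W] by blast
    with W show "\<exists>W'. (openin X W' \<and> x \<in> W' \<and> W' \<subseteq> U) \<and>
        (\<exists>F. closedin X F \<and> W' \<subseteq> F \<and> F \<subseteq> W)"
      by (intro exI[of _ W']) auto
  qed
  then obtain f where f_F: "\<forall>n :: nat. (openin X (f n) \<and> x \<in> f n \<and> f n \<subseteq> U) \<and>
      (\<exists>F. closedin X F \<and> f (Suc n) \<subseteq> F \<and> F \<subseteq> f n)"
    by (elim exE)
  then have f: "openin X (f n) \<and> x \<in> f n \<and> f n \<subseteq> U" for n by simp
  have "\<exists>F. closedin X F \<and> f (Suc n) \<subseteq> F \<and> F \<subseteq> f n" for n using f_F by simp
  then obtain F where F: "\<And>n. closedin X (F n)" "\<And>n. f (Suc n) \<subseteq> F n" "\<And>n. F n \<subseteq> f n"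
    by metis
  have fF: "(\<Inter>n. f n) = (\<Inter>n. F n)"
  proof
    show "(\<Inter>n. f n) \<subseteq> (\<Inter>n. F n)" using F(2) by blast
    show "(\<Inter>n. F n) \<subseteq> (\<Inter>n. f n)" using F(3) by blast
  qed
  have "openin X (topspace X \<inter> \<Inter>(range f))"
    using add countable_small[of f] f unfolding kappa_additive_def by blast
  moreover have "f 0 \<subseteq> topspace X"
    using f[of 0] by (intro openin_subset) simp
  then have "topspace X \<inter> \<Inter>(range f) = (\<Inter>n. f n)"
    by auto
  ultimately have "openin X (\<Inter>n. f n)" by simp
  moreover have "closedin X (\<Inter>n. f n)"
    unfolding fF using F(1) by (intro closedin_Inter) auto
  moreover have "x \<in> (\<Inter>n. f n)" "(\<Inter>n. f n) \<subseteq> U"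
    using f by auto
  ultimately show ?thesis using that by blast
qed

text \<open>One clopen set between each pair of members of a base of size \<open>\<kappa>\<close>, where there is one, makes a
  clopen base that is still of size at most \<open>\<kappa>\<close>.\<close>

lemma clopen_base:
  assumes add: "kappa_additive \<kappa> X" and reg: "regular_space X" and weight: "weight_le \<kappa> X"
    and nonempty: "topspace X \<noteq> {}"
  obtains b where "\<And>\<beta>. \<beta> \<in> Field \<kappa> \<Longrightarrow> openin X (b \<beta>) \<and> closedin X (b \<beta>)"
    and "\<And>U x. openin X U \<Longrightarrow> x \<in> U \<Longrightarrow> \<exists>\<beta>\<in>Field \<kappa>. x \<in> b \<beta> \<and> b \<beta> \<subseteq> U"
proof -
  obtain \<B> where \<B>: "|\<B>| \<le>o \<kappa>" "\<And>V. V \<in> \<B> \<Longrightarrow> openin X V"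
    and base: "\<And>U x. openin X U \<Longrightarrow> x \<in> U \<Longrightarrow> \<exists>V\<in>\<B>. x \<in> V \<and> V \<subseteq> U"
    using weight unfolding weight_le_def by metis
  define between where
    "between = (\<lambda>(V, U) K. openin X K \<and> closedin X K \<and> V \<subseteq> K \<and> K \<subseteq> U)"
  define P where "P = {VU \<in> \<B> \<times> \<B>. \<exists>K. between VU K}"
  define k where "k VU = (SOME K. between VU K)" for VU
  have k: "between VU (k VU)" if "VU \<in> P" for VU
    unfolding k_def using that by (intro someI_ex[of "between VU"]) (simp add: P_def)
  have base_P: "\<exists>VU\<in>P. x \<in> k VU \<and> k VU \<subseteq> U" if Ux: "openin X U" "x \<in> U" for U x
  proof -
    obtain U' where U': "U' \<in> \<B>" "x \<in> U'" "U' \<subseteq> U"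
      using base[OF Ux] by blast
    obtain K where K: "openin X K" "closedin X K" "x \<in> K" "K \<subseteq> U'"
      using ex_clopen_neighbourhood[OF add reg \<B>(2)[OF U'(1)] U'(2)] by blast
    obtain V where V: "V \<in> \<B>" "x \<in> V" "V \<subseteq> K"
      using base[OF K(1,3)] by blast
    have "between (V, U') K"
      using K V by (simp add: between_def)
    then have VU: "(V, U') \<in> P"
      using U' V by (auto simp: P_def)
    then show ?thesis
      using k[OF VU] U' V by (intro bexI[of _ "(V, U')"]) (auto simp: between_def)
  qed
  have "|\<B> \<times> \<B>| \<le>o \<kappa>"
    using card_of_Times_ordLeq_infinite_Field[OF infinite_Field \<B>(1) \<B>(1) Card_order] .
  then have "|P| \<le>o \<kappa>"
    by (rule ordLeq_transitive[OF card_of_mono1, rotated]) (auto simp: P_def)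
  then have "|P| \<le>o |Field \<kappa>|"
    using ordIso_symmetric[OF card_of_Field_ordIso[OF Card_order]] ordLeq_ordIso_trans by blast
  moreover have "P \<noteq> {}"
    using base_P[OF openin_topspace] nonempty by blast
  ultimately obtain g where g: "g ` Field \<kappa> = P"
    using card_of_ordLeq2 by metis
  show ?thesis
  proof (rule that[of "\<lambda>\<beta>. k (g \<beta>)"])
    fix \<beta> assume "\<beta> \<in> Field \<kappa>"
    then have "g \<beta> \<in> P" using g by blast
    then show "openin X (k (g \<beta>)) \<and> closedin X (k (g \<beta>))"
      using k[of "g \<beta>"] by (simp add: between_def split: prod.splits)
  next
    fix U x assume "openin X U" "x \<in> U"
    then obtain VU where "VU \<in> P" "x \<in> k VU" "k VU \<subseteq> U" using base_P by blast
    then show "\<exists>\<beta>\<in>Field \<kappa>. x \<in> k (g \<beta>) \<and> k (g \<beta>) \<subseteq> U"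
      using g by (metis imageE)
  qed
qed

text \<open>The points \<open>q i\<close> serve as moves of I, to which \<open>W (q i)\<close> is the answer. They need not be in the
  pieces \<open>C i\<close>, as the game only requires that the later moves stay inside the answer.\<close>

definition open_partition ::
    "'b topology \<Rightarrow> 'b set \<Rightarrow> ('b \<Rightarrow> 'b set) \<Rightarrow> ('k \<Rightarrow> 'b set) \<Rightarrow> ('k \<Rightarrow> 'b) \<Rightarrow> bool" where
  "open_partition X A W C q \<longleftrightarrow>
     (\<forall>i\<in>Field \<kappa>. openin X (C i) \<and> C i \<noteq> {} \<and> q i \<in> A \<and> C i \<subseteq> W (q i)) \<and>
     (\<forall>i\<in>Field \<kappa>. \<forall>j\<in>Field \<kappa>. i \<noteq> j \<longrightarrow> C i \<inter> C j = {}) \<and>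
     (\<Union>i\<in>Field \<kappa>. C i) = A"

text \<open>A cover by \<open>\<kappa>\<close> many clopen sets becomes a partition into open sets by subtracting from each set
  the earlier ones: there are fewer than \<open>\<kappa>\<close> of them, so by additivity their union is closed. If the
  cover also refines one without a subcover of size less than \<open>\<kappa>\<close>, then \<open>\<kappa>\<close> many of the pieces are
  nonempty, and these can be indexed by \<open>\<kappa>\<close>.\<close>

lemma ex_open_partition:
  assumes add: "kappa_additive \<kappa> X"
    and clopen: "\<And>\<beta>. \<beta> \<in> Field \<kappa> \<Longrightarrow> openin X (b \<beta>) \<and> closedin X (b \<beta>)"
    and base: "\<And>U x. openin X U \<Longrightarrow> x \<in> U \<Longrightarrow> \<exists>\<beta>\<in>Field \<kappa>. x \<in> b \<beta> \<and> b \<beta> \<subseteq> U"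
    and A: "openin X A" "\<not> kappa_Lindelof_in \<kappa> X A"
    and W: "\<And>x. x \<in> A \<Longrightarrow> openin X (W x) \<and> x \<in> W x"
  obtains C q where "open_partition X A W C q"
proof -
  have top: "topspace (subtopology X A) = A"
    using A(1) by (rule topspace_subtopology_subset[OF openin_subset])
  obtain \<U> where \<U>: "\<And>O'. O' \<in> \<U> \<Longrightarrow> openin (subtopology X A) O'" "\<Union>\<U> = A"
    and no_small_subcover: "\<And>\<V>. |\<V>| <o \<kappa> \<Longrightarrow> \<V> \<subseteq> \<U> \<Longrightarrow> \<Union>\<V> \<noteq> A"
    using A openin_subset[OF A(1)]
    unfolding kappa_Lindelof_in_def kappa_Lindelof_space_def top by metis
  have \<U>_open: "openin X O'" if "O' \<in> \<U>" for O'
    using \<U>(1)[OF that] A(1) by (simp add: openin_open_subtopology)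
  have "\<forall>x\<in>A. \<exists>S. S \<in> \<U> \<and> x \<in> S"
    using \<U>(2) by blast
  then obtain cov where cov: "\<And>x. x \<in> A \<Longrightarrow> cov x \<in> \<U> \<and> x \<in> cov x"
    by metis
  define fits where "fits \<beta> x \<longleftrightarrow> x \<in> A \<and> b \<beta> \<subseteq> W x \<inter> cov x" for \<beta> x
  define T where "T = {\<beta> \<in> Field \<kappa>. \<exists>x. fits \<beta> x}"
  define p where "p \<beta> = (SOME x. fits \<beta> x)" for \<beta>
  have p: "fits \<beta> (p \<beta>)" if "\<beta> \<in> T" for \<beta>
    unfolding p_def using that by (intro someI_ex[of "fits \<beta>"]) (simp add: T_def)
  have b_sub: "b \<beta> \<subseteq> A" if "\<beta> \<in> T" for \<beta>
    using p[OF that] cov \<U>(2) unfolding fits_def by blast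
  have b_cover: "\<exists>\<beta>\<in>T. x \<in> b \<beta>" if x: "x \<in> A" for x
  proof -
    have "openin X (W x \<inter> cov x)" "x \<in> W x \<inter> cov x"
      using W[OF x] cov[OF x] \<U>_open by auto
    then obtain \<beta> where "\<beta> \<in> Field \<kappa>" "x \<in> b \<beta>" "b \<beta> \<subseteq> W x \<inter> cov x"
      using base[of "W x \<inter> cov x" x] by blast
    then show ?thesis using x by (intro bexI[of _ \<beta>]) (auto simp: T_def fits_def)
  qed
  define D where "D \<beta> = b \<beta> - (\<Union>\<gamma>\<in>T \<inter> underS \<kappa> \<beta>. b \<gamma>)" for \<beta>
  have T_Field: "T \<subseteq> Field \<kappa>" by (auto simp: T_def)
  have D_sub: "D \<beta> \<subseteq> b \<beta>" for \<beta> by (auto simp: D_def)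
  have D_open: "openin X (D \<beta>)" if \<beta>: "\<beta> \<in> Field \<kappa>" for \<beta>
  proof -
    have small: "|T \<inter> underS \<kappa> \<beta>| <o \<kappa>"
      by (rule small_subset[OF underS_small[OF \<beta>]]) blast
    have "closedin X (\<Union>\<gamma>\<in>T \<inter> underS \<kappa> \<beta>. b \<gamma>)"
      using clopen T_Field by (intro additive_Union_closedin[OF add small]) blast
    then show ?thesis
      unfolding D_def using clopen[OF \<beta>] by (simp add: openin_diff)
  qed
  have D_disjoint: "D \<beta> \<inter> D \<gamma> = {}" if "\<beta> \<in> T" "\<gamma> \<in> T" "\<beta> \<noteq> \<gamma>" for \<beta> \<gamma>
  proof -
    have "\<beta> \<in> underS \<kappa> \<gamma> \<or> \<gamma> \<in> underS \<kappa> \<beta>"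
      using underS_linear[of \<beta> \<gamma>] that T_Field by blast
    then show ?thesis using that by (auto simp: D_def)
  qed
  have D_cover: "(\<Union>\<beta>\<in>T. D \<beta>) = A"
  proof
    show "(\<Union>\<beta>\<in>T. D \<beta>) \<subseteq> A" using b_sub D_sub by blast
    show "A \<subseteq> (\<Union>\<beta>\<in>T. D \<beta>)"
    proof
      fix x assume "x \<in> A"
      then obtain \<beta> where \<beta>: "\<beta> \<in> T" "x \<in> b \<beta>" using b_cover by blast
      then obtain \<gamma> where "\<gamma> \<in> T \<and> x \<in> b \<gamma>"
        and least: "\<And>\<delta>. \<delta> \<in> underS \<kappa> \<gamma> \<Longrightarrow> \<not> (\<delta> \<in> T \<and> x \<in> b \<delta>)"
        using ex_least[of \<beta> "\<lambda>\<beta>. \<beta> \<in> T \<and> x \<in> b \<beta>"] T_Field by blast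
      then have "\<gamma> \<in> T" "x \<in> D \<gamma>" by (auto simp: D_def)
      then show "x \<in> (\<Union>\<beta>\<in>T. D \<beta>)" by blast
    qed
  qed
  define T' where "T' = {\<beta> \<in> T. D \<beta> \<noteq> {}}"
  have D_cover': "(\<Union>\<beta>\<in>T'. D \<beta>) = A"
    using D_cover by (auto simp: T'_def)
  have "\<not> |T'| <o \<kappa>"
  proof
    assume small: "|T'| <o \<kappa>"
    have sub: "(\<lambda>\<beta>. cov (p \<beta>)) ` T' \<subseteq> \<U>"
      using p cov by (auto simp: T'_def fits_def)
    have "D \<beta> \<subseteq> cov (p \<beta>)" if "\<beta> \<in> T'" for \<beta>
      using p[of \<beta>] that D_sub[of \<beta>] by (auto simp: T'_def fits_def)
    then have "A \<subseteq> \<Union>((\<lambda>\<beta>. cov (p \<beta>)) ` T')"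
      using D_cover' by blast
    moreover have "\<Union>((\<lambda>\<beta>. cov (p \<beta>)) ` T') \<subseteq> A"
      using sub \<U>(2) by blast
    ultimately show False
      using no_small_subcover[OF small_image[OF small] sub] by blast
  qed
  moreover have "T' \<subseteq> Field \<kappa>"
    using T_Field by (auto simp: T'_def)
  then have "|T'| \<le>o \<kappa>"
    by (rule ordLeq_ordIso_trans[OF card_of_mono1 card_of_Field_ordIso[OF Card_order]])
  ultimately have "|T'| =o \<kappa>"
    using ordLeq_iff_ordLess_or_ordIso by blast
  then have "|Field \<kappa>| =o |T'|"
    by (rule ordIso_transitive[OF card_of_Field_ordIso[OF Card_order] ordIso_symmetric])
  then obtain e where e: "bij_betw e (Field \<kappa>) T'"
    using card_of_ordIso by blast
  have e_T': "e i \<in> T'" if "i \<in> Field \<kappa>" for i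
    using bij_betwE[OF e] that by blast
  have "open_partition X A W (\<lambda>i. D (e i)) (\<lambda>i. p (e i))"
    unfolding open_partition_def
  proof (intro conjI ballI impI)
    fix i assume i: "i \<in> Field \<kappa>"
    note e_T'[OF i]
    then have eT: "e i \<in> T" "D (e i) \<noteq> {}" by (auto simp: T'_def)
    then show "openin X (D (e i))" "D (e i) \<noteq> {}"
      using D_open T_Field by auto
    show "p (e i) \<in> A" "D (e i) \<subseteq> W (p (e i))"
      using p[OF eT(1)] D_sub[of "e i"] by (auto simp: fits_def)
  next
    fix i j assume ij: "i \<in> Field \<kappa>" "j \<in> Field \<kappa>" "i \<noteq> j"
    then have "e i \<noteq> e j" using e by (meson bij_betw_imp_inj_on inj_onD)
    then show "D (e i) \<inter> D (e j) = {}"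
      using e_T'[OF ij(1)] e_T'[OF ij(2)] D_disjoint by (simp add: T'_def)
  next
    have "(\<Union>i\<in>Field \<kappa>. D (e i)) = (\<Union>\<beta>\<in>e ` Field \<kappa>. D \<beta>)" by blast
    then show "(\<Union>i\<in>Field \<kappa>. D (e i)) = A"
      using D_cover' bij_betw_imp_surj_on[OF e] by simp
  qed
  then show ?thesis using that by blast
qed

end

section \<open>The tree of open sets given by a winning strategy\<close>

locale choquet_scheme = uncountable_regular \<kappa> for \<kappa> :: "'k rel" +
  fixes X :: "'a topology" and \<sigma> :: "('k, 'a) choquet_strategy" and b :: "'k \<Rightarrow> 'a set"
  assumes nonempty: "topspace X \<noteq> {}"
    and additive: "kappa_additive \<kappa> X"
    and Hausdorff: "Hausdorff_space X"
    and winning: "choquet_winning_II \<kappa> X \<sigma>"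
    and Lindelof_empty: "Lindelof_sets_empty_interior \<kappa> X"
    and b_clopen: "\<And>\<beta>. \<beta> \<in> Field \<kappa> \<Longrightarrow> openin X (b \<beta>) \<and> closedin X (b \<beta>)"
    and b_base: "\<And>U x. openin X U \<Longrightarrow> x \<in> U \<Longrightarrow> \<exists>\<beta>\<in>Field \<kappa>. x \<in> b \<beta> \<and> b \<beta> \<subseteq> U"
begin

text \<open>The moves of II in the run in which I plays \<open>(U, x)\<close> and II follows \<open>\<sigma>\<close>. Defining them by recursion on
  the round, without asking whether the moves of I are legal, makes them total functions of \<open>U\<close> and
  \<open>x\<close> that depend on the past only.\<close>

definition reply :: "('k \<Rightarrow> 'a set) \<Rightarrow> ('k \<Rightarrow> 'a) \<Rightarrow> 'k \<Rightarrow> 'a set" where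
  "reply U x = wo_rel.worec \<kappa> (\<lambda>V \<alpha>.
     \<sigma> \<alpha> (restrict U (under \<kappa> \<alpha>)) (restrict x (under \<kappa> \<alpha>)) (restrict V (underS \<kappa> \<alpha>)))"

lemma reply_unfold:
  "reply U x \<alpha> =
     \<sigma> \<alpha> (restrict U (under \<kappa> \<alpha>)) (restrict x (under \<kappa> \<alpha>)) (restrict (reply U x) (underS \<kappa> \<alpha>))"
proof -
  have "wo_rel.adm_wo \<kappa> (\<lambda>V \<alpha>.
     \<sigma> \<alpha> (restrict U (under \<kappa> \<alpha>)) (restrict x (under \<kappa> \<alpha>)) (restrict V (underS \<kappa> \<alpha>)))"
    unfolding wo_rel.adm_wo_def[OF wo_rel] by (metis restrict_ext)
  from wo_rel.worec_fixpoint[OF wo_rel this] show ?thesis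
    unfolding reply_def by (rule fun_cong)
qed

lemma under_trans: "\<beta> \<in> underS \<kappa> \<alpha> \<Longrightarrow> \<gamma> \<in> under \<kappa> \<beta> \<Longrightarrow> \<gamma> \<in> underS \<kappa> \<alpha>"
  using underS_trans[of \<gamma> \<beta> \<alpha>] by (auto simp: under_def underS_def)

lemma underS_subset_under: "underS \<kappa> \<alpha> \<subseteq> under \<kappa> \<alpha>"
  by (auto simp: under_def underS_def)

lemma reply_cong:
  assumes "\<And>\<beta>. \<beta> \<in> under \<kappa> \<alpha> \<Longrightarrow> U \<beta> = U' \<beta> \<and> x \<beta> = x' \<beta>"
  shows "reply U x \<alpha> = reply U' x' \<alpha>"
proof -
  have "(\<forall>\<beta>\<in>under \<kappa> \<alpha>. U \<beta> = U' \<beta> \<and> x \<beta> = x' \<beta>) \<longrightarrow> reply U x \<alpha> = reply U' x' \<alpha>"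
  proof (rule wo_rel.well_order_induct[OF wo_rel,
        of "\<lambda>\<alpha>. (\<forall>\<beta>\<in>under \<kappa> \<alpha>. U \<beta> = U' \<beta> \<and> x \<beta> = x' \<beta>) \<longrightarrow> reply U x \<alpha> = reply U' x' \<alpha>"], rule impI)
    fix \<alpha>
    assume IH: "\<forall>\<beta>. \<beta> \<noteq> \<alpha> \<and> (\<beta>, \<alpha>) \<in> \<kappa> \<longrightarrow>
        (\<forall>\<gamma>\<in>under \<kappa> \<beta>. U \<gamma> = U' \<gamma> \<and> x \<gamma> = x' \<gamma>) \<longrightarrow> reply U x \<beta> = reply U' x' \<beta>"
      and eq: "\<forall>\<beta>\<in>under \<kappa> \<alpha>. U \<beta> = U' \<beta> \<and> x \<beta> = x' \<beta>"
    have "reply U x \<beta> = reply U' x' \<beta>" if \<beta>: "\<beta> \<in> underS \<kappa> \<alpha>" for \<beta>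
    proof -
      have "\<forall>\<gamma>\<in>under \<kappa> \<beta>. U \<gamma> = U' \<gamma> \<and> x \<gamma> = x' \<gamma>"
        using eq under_trans[OF \<beta>] underS_subset_under by blast
      then show ?thesis using IH \<beta> by (simp add: underS_def)
    qed
    then have "restrict (reply U x) (underS \<kappa> \<alpha>) = restrict (reply U' x') (underS \<kappa> \<alpha>)"
      by (rule restrict_ext)
    moreover have "restrict U (under \<kappa> \<alpha>) = restrict U' (under \<kappa> \<alpha>)"
      "restrict x (under \<kappa> \<alpha>) = restrict x' (under \<kappa> \<alpha>)"
      using eq by (auto intro: restrict_ext)
    ultimately show "reply U x \<alpha> = reply U' x' \<alpha>"
      unfolding reply_unfold[of U x \<alpha>] reply_unfold[of U' x' \<alpha>] by simp
  qed
  then show ?thesis using assms by blast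
qed

lemma reply_wins:
  assumes D: "ofilter \<kappa> D"
    and legal: "\<And>\<alpha>. \<alpha> \<in> D \<Longrightarrow> choquet_legal_I \<kappa> X U x (reply U x) \<alpha>"
  shows "\<alpha> \<in> D \<Longrightarrow> openin X (reply U x \<alpha>) \<and> x \<alpha> \<in> reply U x \<alpha> \<and> reply U x \<alpha> \<subseteq> U \<alpha>"
    and "limit_segment \<kappa> D \<Longrightarrow> (\<Inter>\<alpha>\<in>D. reply U x \<alpha>) \<noteq> {}"
proof -
  have "choquet_follows \<kappa> \<sigma> U x (reply U x) \<alpha>" for \<alpha>
    unfolding choquet_follows_def by (rule reply_unfold)
  then have wins: "(\<forall>\<alpha>\<in>D. choquet_legal_II \<kappa> X U x (reply U x) \<alpha>) \<and>
      (limit_segment \<kappa> D \<longrightarrow> (\<Inter>\<alpha>\<in>D. reply U x \<alpha>) \<noteq> {})"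
    using winning[unfolded choquet_winning_II_def, rule_format, of D U x "reply U x"] D legal
    by simp
  then show "limit_segment \<kappa> D \<Longrightarrow> (\<Inter>\<alpha>\<in>D. reply U x \<alpha>) \<noteq> {}" by blast
  have open_reply: "openin X (reply U x \<alpha>)" if \<alpha>: "\<alpha> \<in> D" for \<alpha>
  proof -
    have "\<alpha> \<in> Field \<kappa>" using \<alpha> D by (auto simp: ofilter_def)
    then have "\<alpha> \<in> D \<longrightarrow> ?thesis"
    proof (induction rule: less_induct)
      case (less \<alpha>)
      show ?case
      proof
        assume \<alpha>: "\<alpha> \<in> D"
        have "\<beta> \<in> D" if "\<beta> \<in> underS \<kappa> \<alpha>" for \<beta>
          using that \<alpha> D underS_subset_under[of \<alpha>] unfolding ofilter_def by blast
        then have "openin X (choquet_remaining \<kappa> X (reply U x) \<alpha>)"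
          using less by (intro openin_choquet_remaining[OF additive]) auto
        moreover have "openin (subtopology X (choquet_remaining \<kappa> X (reply U x) \<alpha>)) (reply U x \<alpha>)"
          using wins \<alpha> by (simp add: choquet_legal_II_def)
        ultimately show "openin X (reply U x \<alpha>)"
          by (simp add: openin_open_subtopology)
      qed
    qed
    then show ?thesis using \<alpha> by blast
  qed
  show "openin X (reply U x \<alpha>) \<and> x \<alpha> \<in> reply U x \<alpha> \<and> reply U x \<alpha> \<subseteq> U \<alpha>" if \<alpha>: "\<alpha> \<in> D"
    using wins \<alpha> open_reply[OF \<alpha>] by (simp add: choquet_legal_II_def)
qed

text \<open>For a history of pieces \<open>c\<close> and points \<open>p\<close>, \<open>target c p \<alpha> z\<close> is a neighbourhood of \<open>z\<close> in the
  current set: it is inside the answer of \<open>\<sigma>\<close> to \<open>z\<close>, so that the run can go on in it, and it lies on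
  one side of the \<open>\<alpha>\<close>-th basic set, so that branches separate points.\<close>

definition target :: "('k \<Rightarrow> 'a set) \<Rightarrow> ('k \<Rightarrow> 'a) \<Rightarrow> 'k \<Rightarrow> 'a \<Rightarrow> 'a set" where
  "target c p \<alpha> z =
     reply (choquet_remaining \<kappa> X c) (p(\<alpha> := z)) \<alpha> \<inter>
     (if z \<in> b \<alpha> then b \<alpha> else topspace X - b \<alpha>)"

definition pieces :: "('k \<Rightarrow> 'a set) \<Rightarrow> ('k \<Rightarrow> 'a) \<Rightarrow> 'k \<Rightarrow> ('k \<Rightarrow> 'a set) \<times> ('k \<Rightarrow> 'a)" where
  "pieces c p \<alpha> =
     (SOME Cq. open_partition X (choquet_remaining \<kappa> X c \<alpha>) (target c p \<alpha>) (fst Cq) (snd Cq))"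

lemma choquet_remaining_cong:
  "(\<And>\<beta>. \<beta> \<in> underS \<kappa> \<alpha> \<Longrightarrow> c \<beta> = c' \<beta>) \<Longrightarrow>
     choquet_remaining \<kappa> X c \<alpha> = choquet_remaining \<kappa> X c' \<alpha>"
  by (simp add: choquet_remaining_def)

lemma pieces_cong:
  assumes "\<And>\<beta>. \<beta> \<in> underS \<kappa> \<alpha> \<Longrightarrow> c \<beta> = c' \<beta> \<and> p \<beta> = p' \<beta>"
  shows "pieces c p \<alpha> = pieces c' p' \<alpha>"
proof -
  have rem: "choquet_remaining \<kappa> X c \<beta> = choquet_remaining \<kappa> X c' \<beta>"
    if "\<beta> = \<alpha> \<or> \<beta> \<in> underS \<kappa> \<alpha>" for \<beta>
    using that assms underS_trans[of _ \<beta> \<alpha>] by (intro choquet_remaining_cong) auto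
  have "reply (choquet_remaining \<kappa> X c) (p(\<alpha> := z)) \<alpha>
      = reply (choquet_remaining \<kappa> X c') (p'(\<alpha> := z)) \<alpha>" for z
  proof (rule reply_cong)
    fix \<beta> assume "\<beta> \<in> under \<kappa> \<alpha>"
    then have "\<beta> = \<alpha> \<or> \<beta> \<in> underS \<kappa> \<alpha>" by (auto simp: under_def underS_def)
    then show "choquet_remaining \<kappa> X c \<beta> = choquet_remaining \<kappa> X c' \<beta> \<and>
        (p(\<alpha> := z)) \<beta> = (p'(\<alpha> := z)) \<beta>"
      using rem assms by auto
  qed
  then have "target c p \<alpha> = target c' p' \<alpha>"
    by (simp add: target_def fun_eq_iff)
  then show ?thesis
    using rem[of \<alpha>] by (simp add: pieces_def)
qed

text \<open>A sequence \<open>f\<close> of indices selects a branch of the tree. In round \<open>\<alpha>\<close> the set of points that is left,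
  \<open>node f \<alpha>\<close>, is the intersection of the earlier pieces; it is partitioned, and \<open>f \<alpha>\<close> says in which piece
  to continue. In the run of the game that belongs to \<open>f\<close>, player I plays \<open>(node f \<alpha>, point f \<alpha>)\<close>. Taking
  the intersection in every round treats successor and limit rounds alike.\<close>

definition branch :: "('k \<Rightarrow> 'k) \<Rightarrow> 'k \<Rightarrow> 'a set \<times> 'a" where
  "branch f = wo_rel.worec \<kappa> (\<lambda>g \<alpha>.
     let Cq = pieces (\<lambda>\<beta>. fst (g \<beta>)) (\<lambda>\<beta>. snd (g \<beta>)) \<alpha> in (fst Cq (f \<alpha>), snd Cq (f \<alpha>)))"

definition piece :: "('k \<Rightarrow> 'k) \<Rightarrow> 'k \<Rightarrow> 'a set" where
  "piece f \<alpha> = fst (branch f \<alpha>)"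

definition point :: "('k \<Rightarrow> 'k) \<Rightarrow> 'k \<Rightarrow> 'a" where
  "point f \<alpha> = snd (branch f \<alpha>)"

definition node :: "('k \<Rightarrow> 'k) \<Rightarrow> 'k \<Rightarrow> 'a set" where
  "node f \<alpha> = choquet_remaining \<kappa> X (piece f) \<alpha>"

lemma branch_unfold:
  "piece f \<alpha> = fst (pieces (piece f) (point f) \<alpha>) (f \<alpha>)"
  "point f \<alpha> = snd (pieces (piece f) (point f) \<alpha>) (f \<alpha>)"
proof -
  let ?H = "\<lambda>g \<alpha>. let Cq = pieces (\<lambda>\<beta>. fst (g \<beta>)) (\<lambda>\<beta>. snd (g \<beta>)) \<alpha>
    in (fst Cq (f \<alpha>), snd Cq (f \<alpha>))"
  have "wo_rel.adm_wo \<kappa> ?H"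
    unfolding wo_rel.adm_wo_def[OF wo_rel]
  proof (intro allI impI)
    fix g h :: "'k \<Rightarrow> 'a set \<times> 'a" and \<alpha>
    assume "\<forall>\<beta>\<in>underS \<kappa> \<alpha>. g \<beta> = h \<beta>"
    then have "pieces (\<lambda>\<beta>. fst (g \<beta>)) (\<lambda>\<beta>. snd (g \<beta>)) \<alpha>
        = pieces (\<lambda>\<beta>. fst (h \<beta>)) (\<lambda>\<beta>. snd (h \<beta>)) \<alpha>"
      by (intro pieces_cong) simp
    then show "?H g \<alpha> = ?H h \<alpha>" by simp
  qed
  from wo_rel.worec_fixpoint[OF wo_rel this] have "branch f \<alpha> = ?H (branch f) \<alpha>"
    unfolding branch_def by (rule fun_cong)
  then have "branch f \<alpha> = (fst (pieces (piece f) (point f) \<alpha>) (f \<alpha>),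
      snd (pieces (piece f) (point f) \<alpha>) (f \<alpha>))"
    by (simp add: Let_def piece_def[abs_def] point_def[abs_def])
  then show "piece f \<alpha> = fst (pieces (piece f) (point f) \<alpha>) (f \<alpha>)"
    "point f \<alpha> = snd (pieces (piece f) (point f) \<alpha>) (f \<alpha>)"
    by (simp_all add: piece_def[of f \<alpha>] point_def[of f \<alpha>])
qed

lemma branch_cong:
  assumes "\<alpha> \<in> Field \<kappa>" "\<And>\<beta>. \<beta> \<in> under \<kappa> \<alpha> \<Longrightarrow> f \<beta> = g \<beta>"
  shows "piece f \<alpha> = piece g \<alpha> \<and> point f \<alpha> = point g \<alpha>"
proof -
  have "(\<forall>\<beta>\<in>under \<kappa> \<alpha>. f \<beta> = g \<beta>) \<longrightarrow> piece f \<alpha> = piece g \<alpha> \<and> point f \<alpha> = point g \<alpha>"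
    using assms(1)
  proof (induction rule: less_induct)
    case (less \<alpha>)
    show ?case
    proof
      assume eq: "\<forall>\<beta>\<in>under \<kappa> \<alpha>. f \<beta> = g \<beta>"
      have "piece f \<beta> = piece g \<beta> \<and> point f \<beta> = point g \<beta>" if \<beta>: "\<beta> \<in> underS \<kappa> \<alpha>" for \<beta>
      proof -
        have "\<forall>\<gamma>\<in>under \<kappa> \<beta>. f \<gamma> = g \<gamma>"
          using eq under_trans[OF \<beta>] underS_subset_under by blast
        then show ?thesis using less.IH[OF \<beta>] by simp
      qed
      then have "pieces (piece f) (point f) \<alpha> = pieces (piece g) (point g) \<alpha>"
        by (rule pieces_cong)
      moreover have "f \<alpha> = g \<alpha>" using eq under_eq[OF less.hyps] by simp
      ultimately show "piece f \<alpha> = piece g \<alpha> \<and> point f \<alpha> = point g \<alpha>"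
        by (simp add: branch_unfold[of f \<alpha>] branch_unfold[of g \<alpha>])
    qed
  qed
  then show ?thesis using assms(2) by blast
qed

lemma node_cong:
  assumes "\<And>\<beta>. \<beta> \<in> underS \<kappa> \<alpha> \<Longrightarrow> f \<beta> = g \<beta>"
  shows "node f \<alpha> = node g \<alpha>"
  unfolding node_def
proof (rule choquet_remaining_cong)
  fix \<beta> assume \<beta>: "\<beta> \<in> underS \<kappa> \<alpha>"
  then have "\<And>\<gamma>. \<gamma> \<in> under \<kappa> \<beta> \<Longrightarrow> f \<gamma> = g \<gamma>"
    using under_trans[OF \<beta>] assms by blast
  then show "piece f \<beta> = piece g \<beta>"
    using branch_cong[of \<beta> f g] underS_FieldD(1)[OF \<beta>] by blast
qed

lemma mem_node: "x \<in> node f \<alpha> \<longleftrightarrow> x \<in> topspace X \<and> (\<forall>\<beta>\<in>underS \<kappa> \<alpha>. x \<in> piece f \<beta>)"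
  by (auto simp: node_def choquet_remaining_def)

text \<open>The partition selected by \<open>pieces\<close> is a genuine one only if a subordinate partition of the node
  exists. This is the invariant of the construction, established for all branches in \<open>splits_all\<close>.\<close>

definition splits :: "('k \<Rightarrow> 'k) \<Rightarrow> 'k \<Rightarrow> bool" where
  "splits f \<alpha> \<longleftrightarrow> open_partition X (node f \<alpha>) (target (piece f) (point f) \<alpha>)
     (fst (pieces (piece f) (point f) \<alpha>)) (snd (pieces (piece f) (point f) \<alpha>))"

lemma piece_upd: "\<alpha> \<in> Field \<kappa> \<Longrightarrow> piece (f(\<alpha> := i)) \<alpha> = fst (pieces (piece f) (point f) \<alpha>) i"
proof -
  assume \<alpha>: "\<alpha> \<in> Field \<kappa>"
  have "pieces (piece (f(\<alpha> := i))) (point (f(\<alpha> := i))) \<alpha> = pieces (piece f) (point f) \<alpha>"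
  proof (rule pieces_cong, rule branch_cong)
    fix \<beta> assume \<beta>: "\<beta> \<in> underS \<kappa> \<alpha>"
    then show "\<beta> \<in> Field \<kappa>" by (rule underS_FieldD)
    fix \<gamma> assume "\<gamma> \<in> under \<kappa> \<beta>"
    then have "\<gamma> \<in> underS \<kappa> \<alpha>" by (rule under_trans[OF \<beta>])
    then show "(f(\<alpha> := i)) \<gamma> = f \<gamma>" by (auto simp: underS_def)
  qed
  then show ?thesis by (simp add: branch_unfold(1)[of "f(\<alpha> := i)"])
qed

lemma splits_piece:
  assumes "splits f \<alpha>" "f \<alpha> \<in> Field \<kappa>"
  shows "openin X (piece f \<alpha>)" "piece f \<alpha> \<noteq> {}" "piece f \<alpha> \<subseteq> node f \<alpha>"
    and "point f \<alpha> \<in> node f \<alpha>"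
    and "piece f \<alpha> \<subseteq> reply (node f) (point f) \<alpha>"
    and "piece f \<alpha> \<subseteq> b \<alpha> \<or> piece f \<alpha> \<inter> b \<alpha> = {}"
proof -
  have part: "openin X (piece f \<alpha>) \<and> piece f \<alpha> \<noteq> {} \<and>
      point f \<alpha> \<in> node f \<alpha> \<and> piece f \<alpha> \<subseteq> target (piece f) (point f) \<alpha> (point f \<alpha>)"
    using assms unfolding splits_def open_partition_def
    by (simp add: branch_unfold[of f \<alpha>])
  then show "openin X (piece f \<alpha>)" "piece f \<alpha> \<noteq> {}"
    "point f \<alpha> \<in> node f \<alpha>" by simp_all
  have "(\<Union>i\<in>Field \<kappa>. fst (pieces (piece f) (point f) \<alpha>) i) = node f \<alpha>"
    using assms(1) unfolding splits_def open_partition_def by simp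
  then show "piece f \<alpha> \<subseteq> node f \<alpha>"
    unfolding branch_unfold(1)[of f \<alpha>] using assms(2) by blast
  have "piece f \<alpha> \<subseteq> reply (node f) (point f) \<alpha> \<inter>
      (if point f \<alpha> \<in> b \<alpha> then b \<alpha> else topspace X - b \<alpha>)"
    using part by (simp add: target_def node_def[abs_def])
  then show "piece f \<alpha> \<subseteq> reply (node f) (point f) \<alpha>"
    "piece f \<alpha> \<subseteq> b \<alpha> \<or> piece f \<alpha> \<inter> b \<alpha> = {}"
    by (auto split: if_splits)
qed

lemma openin_node:
  assumes \<alpha>: "\<alpha> \<in> Field \<kappa>"
    and splits: "\<And>\<beta>. \<beta> \<in> underS \<kappa> \<alpha> \<Longrightarrow> splits f \<beta> \<and> f \<beta> \<in> Field \<kappa>"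
  shows "openin X (node f \<alpha>)"
  unfolding node_def using splits splits_piece(1)
  by (intro openin_choquet_remaining[OF additive \<alpha>]) blast

text \<open>The moves \<open>V\<close> of II are a parameter because two runs need this lemma: the run of the branch, and
  its variant with another last point.\<close>

lemma node_legal:
  assumes \<alpha>: "\<alpha> \<in> Field \<kappa>"
    and splits: "\<And>\<beta>. \<beta> \<in> underS \<kappa> \<alpha> \<Longrightarrow> splits f \<beta> \<and> f \<beta> \<in> Field \<kappa>"
    and V: "\<And>\<beta>. \<beta> \<in> underS \<kappa> \<alpha> \<Longrightarrow> V \<beta> = reply (node f) (point f) \<beta>"
    and x: "x \<alpha> \<in> node f \<alpha>"
  shows "choquet_legal_I \<kappa> X (node f) x V \<alpha>"
proof -
  have "node f \<alpha> \<subseteq> V \<beta>" if \<beta>: "\<beta> \<in> underS \<kappa> \<alpha>" for \<beta>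
  proof -
    have "piece f \<beta> \<subseteq> V \<beta>"
      using splits_piece(5)[of f \<beta>] splits[OF \<beta>] V[OF \<beta>] by simp
    then show ?thesis using \<beta> by (auto simp: mem_node)
  qed
  then have "node f \<alpha> = node f \<alpha> \<inter> choquet_remaining \<kappa> X V \<alpha>"
    by (auto simp: choquet_remaining_def mem_node)
  then have "openin (subtopology X (choquet_remaining \<kappa> X V \<alpha>)) (node f \<alpha>)"
    using openin_node[OF \<alpha> splits] unfolding openin_subtopology by blast
  then show ?thesis using x by (simp add: choquet_legal_I_def)
qed

lemma ofilter_FieldD: "ofilter \<kappa> D \<Longrightarrow> \<alpha> \<in> D \<Longrightarrow> \<alpha> \<in> Field \<kappa>"
  by (auto simp: ofilter_def)

lemma ofilter_underSD: "ofilter \<kappa> D \<Longrightarrow> \<alpha> \<in> D \<Longrightarrow> \<beta> \<in> underS \<kappa> \<alpha> \<Longrightarrow> \<beta> \<in> D"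
  by (auto simp: ofilter_def under_def underS_def)

text \<open>The pieces of a branch are interleaved with the moves of II in its run: each piece contains the
  next node, which contains the next move. So a point common to all moves of II, as the winning
  strategy provides it at a limit, is common to all pieces.\<close>

lemma branch_limit:
  assumes D: "limit_segment \<kappa> D"
    and splits: "\<And>\<beta>. \<beta> \<in> D \<Longrightarrow> splits f \<beta> \<and> f \<beta> \<in> Field \<kappa>"
  shows "(\<Inter>\<beta>\<in>D. piece f \<beta>) \<noteq> {}"
proof -
  have D': "ofilter \<kappa> D" "\<And>\<alpha>. \<alpha> \<in> D \<Longrightarrow> \<exists>\<beta>\<in>D. \<alpha> \<in> underS \<kappa> \<beta>"
    using D by (auto simp: limit_segment_def)
  have legal: "choquet_legal_I \<kappa> X (node f) (point f) (reply (node f) (point f)) \<alpha>"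
    if \<alpha>: "\<alpha> \<in> D" for \<alpha>
  proof (rule node_legal)
    show "\<alpha> \<in> Field \<kappa>" using D'(1) \<alpha> by (rule ofilter_FieldD)
    show "splits f \<beta> \<and> f \<beta> \<in> Field \<kappa>" if "\<beta> \<in> underS \<kappa> \<alpha>" for \<beta>
      using splits ofilter_underSD[OF D'(1) \<alpha> that] .
    show "point f \<alpha> \<in> node f \<alpha>"
      using splits_piece(4) splits[OF \<alpha>] by blast
  qed simp
  obtain x where x: "\<And>\<alpha>. \<alpha> \<in> D \<Longrightarrow> x \<in> reply (node f) (point f) \<alpha>"
    using reply_wins(2)[OF D'(1) legal D] by auto
  have "x \<in> piece f \<alpha>" if \<alpha>: "\<alpha> \<in> D" for \<alpha>
  proof -
    obtain \<beta> where \<beta>: "\<beta> \<in> D" "\<alpha> \<in> underS \<kappa> \<beta>" using D'(2)[OF \<alpha>] by blast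
    have "x \<in> node f \<beta>"
      using x[OF \<beta>(1)] reply_wins(1)[OF D'(1) legal \<beta>(1)] by auto
    then show ?thesis using \<beta>(2) by (simp add: mem_node)
  qed
  then show ?thesis by blast
qed

text \<open>At a limit the winning strategy gives a point. At a successor \<open>\<beta> + 1\<close> the node is the piece at \<open>\<beta>\<close>,
  which is nonempty by the choice of the partition.\<close>

lemma node_nonempty:
  assumes \<alpha>: "\<alpha> \<in> Field \<kappa>"
    and splits: "\<And>\<beta>. \<beta> \<in> underS \<kappa> \<alpha> \<Longrightarrow> splits f \<beta> \<and> f \<beta> \<in> Field \<kappa>"
  shows "node f \<alpha> \<noteq> {}"
proof -
  have seg: "ofilter \<kappa> (underS \<kappa> \<alpha>)"
    using wo_rel.underS_ofilter[OF wo_rel] .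
  consider (zero) "underS \<kappa> \<alpha> = {}"
    | (limit) "limit_segment \<kappa> (underS \<kappa> \<alpha>)"
    | (successor) \<beta> where "\<beta> \<in> underS \<kappa> \<alpha>" "\<And>\<gamma>. \<gamma> \<in> underS \<kappa> \<alpha> \<Longrightarrow> \<beta> \<notin> underS \<kappa> \<gamma>"
    using seg by (auto simp: limit_segment_def)
  then show ?thesis
  proof cases
    case zero
    then have "node f \<alpha> = topspace X" by (auto simp: mem_node)
    then show ?thesis using nonempty by simp
  next
    case limit
    then obtain x where x: "\<And>\<beta>. \<beta> \<in> underS \<kappa> \<alpha> \<Longrightarrow> x \<in> piece f \<beta>"
      using branch_limit[OF limit splits] by auto
    obtain \<beta> where "\<beta> \<in> underS \<kappa> \<alpha>" using limit by (auto simp: limit_segment_def)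
    then have "piece f \<beta> \<subseteq> topspace X"
      using splits_piece(1) splits openin_subset by blast
    then have "x \<in> node f \<alpha>"
      using x \<open>\<beta> \<in> underS \<kappa> \<alpha>\<close> by (auto simp: mem_node)
    then show ?thesis by blast
  next
    case successor
    then obtain x where x: "x \<in> piece f \<beta>"
      using splits_piece(2)[of f \<beta>] splits by auto
    then have x': "x \<in> node f \<beta>"
      using splits_piece(3)[of f \<beta>] splits[OF successor(1)] by auto
    have "x \<in> piece f \<gamma>" if \<gamma>: "\<gamma> \<in> underS \<kappa> \<alpha>" for \<gamma>
    proof -
      have "\<gamma> = \<beta> \<or> \<gamma> \<in> underS \<kappa> \<beta>"
        using underS_linear[of \<gamma> \<beta>] successor \<gamma> underS_FieldD(1) by blast
      then show ?thesis using x x' by (auto simp: mem_node)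
    qed
    then have "x \<in> node f \<alpha>" using x' by (simp add: mem_node)
    then show ?thesis by blast
  qed
qed

text \<open>At every node the strategy answers each point \<open>z\<close> of the node with an open neighbourhood of \<open>z\<close>,
  as I may legally extend the run by \<open>z\<close>. The node is a nonempty open set, so it is not
  \<open>\<kappa>\<close>-Lindelof and has a partition of size \<open>\<kappa>\<close> subordinate to these answers.\<close>

lemma splits_all:
  assumes f: "\<And>\<beta>. \<beta> \<in> underS \<kappa> \<alpha> \<Longrightarrow> f \<beta> \<in> Field \<kappa>" and \<alpha>: "\<alpha> \<in> Field \<kappa>"
  shows "splits f \<alpha>"
proof -
  have "(\<forall>\<beta>\<in>underS \<kappa> \<alpha>. f \<beta> \<in> Field \<kappa>) \<longrightarrow> splits f \<alpha>"
    using \<alpha>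
  proof (induction rule: less_induct)
    case (less \<alpha>)
    show ?case
    proof
      assume f: "\<forall>\<beta>\<in>underS \<kappa> \<alpha>. f \<beta> \<in> Field \<kappa>"
      have below: "splits f \<beta> \<and> f \<beta> \<in> Field \<kappa>" if "\<beta> \<in> underS \<kappa> \<alpha>" for \<beta>
        using less.IH[OF that] f that underS_trans by blast
      have node_open: "openin X (node f \<alpha>)"
        using openin_node[OF less.hyps below] .
      have "\<not> kappa_Lindelof_in \<kappa> X (node f \<alpha>)"
      proof
        assume "kappa_Lindelof_in \<kappa> X (node f \<alpha>)"
        then have "X interior_of (node f \<alpha>) = {}"
          using Lindelof_empty by (simp add: Lindelof_sets_empty_interior_def)
        then show False
          using interior_of_openin[OF node_open] node_nonempty[OF less.hyps below] by simp
      qed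
      moreover have "openin X (target (piece f) (point f) \<alpha> z) \<and> z \<in> target (piece f) (point f) \<alpha> z"
        if z: "z \<in> node f \<alpha>" for z
      proof -
        let ?x = "(point f)(\<alpha> := z)"
        have D: "ofilter \<kappa> (under \<kappa> \<alpha>)"
          using wo_rel.under_ofilter[OF wo_rel] .
        have same: "reply (node f) ?x \<beta> = reply (node f) (point f) \<beta>" if \<beta>: "\<beta> \<in> underS \<kappa> \<alpha>" for \<beta>
        proof (rule reply_cong)
          fix \<gamma> assume "\<gamma> \<in> under \<kappa> \<beta>"
          then have "\<gamma> \<noteq> \<alpha>" using under_trans[OF \<beta>] underS_irrefl by blast
          then show "node f \<gamma> = node f \<gamma> \<and> ?x \<gamma> = point f \<gamma>" by simp
        qed
        have legal: "choquet_legal_I \<kappa> X (node f) ?x (reply (node f) ?x) \<beta>" if \<beta>: "\<beta> \<in> under \<kappa> \<alpha>" for \<beta>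
        proof (rule node_legal)
          have \<beta>': "\<beta> = \<alpha> \<or> \<beta> \<in> underS \<kappa> \<alpha>"
            using \<beta> under_eq[OF less.hyps] by blast
          show "\<beta> \<in> Field \<kappa>" using \<beta>' less.hyps underS_FieldD(1) by blast
          have sub: "\<gamma> \<in> underS \<kappa> \<alpha>" if "\<gamma> \<in> underS \<kappa> \<beta>" for \<gamma>
            using \<beta>' that underS_trans by blast
          show "splits f \<gamma> \<and> f \<gamma> \<in> Field \<kappa>" if "\<gamma> \<in> underS \<kappa> \<beta>" for \<gamma>
            using below[OF sub[OF that]] .
          show "reply (node f) ?x \<gamma> = reply (node f) (point f) \<gamma>" if "\<gamma> \<in> underS \<kappa> \<beta>" for \<gamma>
            using same[OF sub[OF that]] .
          show "?x \<beta> \<in> node f \<beta>"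
            using \<beta>' z splits_piece(4)[of f \<beta>] below by (cases "\<beta> = \<alpha>") auto
        qed
        have "openin X (reply (node f) ?x \<alpha>) \<and> ?x \<alpha> \<in> reply (node f) ?x \<alpha>"
          using reply_wins(1)[OF D legal, of \<alpha>] under_eq[OF less.hyps] by simp
        moreover have "openin X (topspace X - b \<alpha>)"
          using b_clopen[OF less.hyps] by (simp add: closedin_def)
        moreover have "z \<in> topspace X" using z by (simp add: mem_node)
        ultimately show ?thesis
          using b_clopen[OF less.hyps] by (simp add: target_def node_def[abs_def] openin_Int)
      qed
      ultimately obtain C q where
        "open_partition X (node f \<alpha>) (target (piece f) (point f) \<alpha>) C q"
        using ex_open_partition[OF additive b_clopen b_base node_open] by blast
      then have "\<exists>Cq. open_partition X (node f \<alpha>) (target (piece f) (point f) \<alpha>) (fst Cq) (snd Cq)"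
        by (intro exI[of _ "(C, q)"]) simp
      then show "splits f \<alpha>"
        unfolding splits_def pieces_def node_def by (rule someI_ex)
    qed
  qed
  then show ?thesis using f by blast
qed

section \<open>The homeomorphism\<close>

lemma piece_disjoint:
  assumes f: "f \<in> Field \<kappa> \<rightarrow> Field \<kappa>" and g: "g \<in> Field \<kappa> \<rightarrow> Field \<kappa>"
    and \<alpha>: "\<alpha> \<in> Field \<kappa>" and same: "\<And>\<beta>. \<beta> \<in> underS \<kappa> \<alpha> \<Longrightarrow> f \<beta> = g \<beta>" and "f \<alpha> \<noteq> g \<alpha>"
  shows "piece f \<alpha> \<inter> piece g \<alpha> = {}"
proof -
  have "splits f \<alpha>" using f \<alpha> underS_FieldD(1) by (intro splits_all) auto
  then have "fst (pieces (piece f) (point f) \<alpha>) (f \<alpha>) \<inter> fst (pieces (piece f) (point f) \<alpha>) (g \<alpha>) = {}"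
    using f g \<alpha> \<open>f \<alpha> \<noteq> g \<alpha>\<close> unfolding splits_def open_partition_def by (simp add: Pi_iff)
  moreover have "piece (f(\<alpha> := g \<alpha>)) \<alpha> = piece g \<alpha>"
  proof -
    have "(f(\<alpha> := g \<alpha>)) \<beta> = g \<beta>" if "\<beta> \<in> under \<kappa> \<alpha>" for \<beta>
      using that under_eq[OF \<alpha>] same by auto
    then show ?thesis using branch_cong[OF \<alpha>] by blast
  qed
  ultimately show ?thesis
    using piece_upd[OF \<alpha>, of f "g \<alpha>"] branch_unfold(1)[of f \<alpha>] by simp
qed

text \<open>The indices are found by recursion: in each round the pieces cover the node, so that one of them
  contains \<open>x\<close>.\<close>

lemma ex_branch_through:
  assumes x: "x \<in> topspace X"
  obtains f where "f \<in> Field \<kappa> \<rightarrow>\<^sub>E Field \<kappa>" "\<And>\<alpha>. \<alpha> \<in> Field \<kappa> \<Longrightarrow> x \<in> piece f \<alpha>"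
proof -
  \<comment> \<open>The implication makes a good index exist even if no piece contains \<open>x\<close>. So all values of \<open>f\<close> are
    indices, and the partitions along \<open>f\<close> are genuine, before \<open>x\<close> is known to be on the branch.\<close>
  define good where "good h \<alpha> i \<longleftrightarrow> i \<in> Field \<kappa> \<and>
      ((\<exists>j\<in>Field \<kappa>. x \<in> piece (h(\<alpha> := j)) \<alpha>) \<longrightarrow> x \<in> piece (h(\<alpha> := i)) \<alpha>)" for h \<alpha> i
  define H where "H h \<alpha> = (if \<alpha> \<in> Field \<kappa> then SOME i. good h \<alpha> i else undefined)" for h \<alpha>
  have "wo_rel.adm_wo \<kappa> H"
    unfolding wo_rel.adm_wo_def[OF wo_rel]
  proof (intro allI impI)
    fix h h' :: "'k \<Rightarrow> 'k" and \<alpha> assume same: "\<forall>\<beta>\<in>underS \<kappa> \<alpha>. h \<beta> = h' \<beta>"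
    show "H h \<alpha> = H h' \<alpha>"
    proof (cases "\<alpha> \<in> Field \<kappa>")
      case True
      have "piece (h(\<alpha> := i)) \<alpha> = piece (h'(\<alpha> := i)) \<alpha>" for i
      proof -
        have "(h(\<alpha> := i)) \<beta> = (h'(\<alpha> := i)) \<beta>" if "\<beta> \<in> under \<kappa> \<alpha>" for \<beta>
          using that under_eq[OF True] same by auto
        then show ?thesis using branch_cong[OF True] by blast
      qed
      then have "good h \<alpha> = good h' \<alpha>" by (simp add: good_def fun_eq_iff)
      then show ?thesis by (simp add: H_def)
    qed (simp add: H_def)
  qed
  then have rec: "wo_rel.worec \<kappa> H = H (wo_rel.worec \<kappa> H)"
    by (rule wo_rel.worec_fixpoint[OF wo_rel])
  define f where "f = wo_rel.worec \<kappa> H"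
  have f_rec: "f \<alpha> = H f \<alpha>" for \<alpha>
    unfolding f_def using fun_cong[OF rec] .
  have good: "good f \<alpha> (f \<alpha>)" if "\<alpha> \<in> Field \<kappa>" for \<alpha>
  proof -
    have "\<exists>i. good f \<alpha> i" using Field_nonempty by (auto simp: good_def)
    then have "good f \<alpha> (SOME i. good f \<alpha> i)" by (rule someI_ex)
    then show ?thesis using that by (simp add: f_rec[of \<alpha>] H_def)
  qed
  have f: "f \<in> Field \<kappa> \<rightarrow>\<^sub>E Field \<kappa>"
    using good f_rec by (auto simp: good_def PiE_iff extensional_def H_def)
  have "x \<in> piece f \<alpha>" if "\<alpha> \<in> Field \<kappa>" for \<alpha>
    using that
  proof (induction rule: less_induct)
    case (less \<alpha>)
    have "splits f \<alpha>"
      using f less.hyps underS_FieldD(1) by (intro splits_all) auto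
    moreover have "x \<in> node f \<alpha>"
      using x less.IH by (simp add: mem_node)
    ultimately obtain j where "j \<in> Field \<kappa>" "x \<in> fst (pieces (piece f) (point f) \<alpha>) j"
      unfolding splits_def open_partition_def by blast
    then have "\<exists>j\<in>Field \<kappa>. x \<in> piece (f(\<alpha> := j)) \<alpha>"
      using piece_upd[OF less.hyps] by auto
    then have "x \<in> piece (f(\<alpha> := f \<alpha>)) \<alpha>"
      using good[OF less.hyps] by (simp add: good_def)
    then show ?case by simp
  qed
  then show ?thesis using that f by blast
qed

definition limit_point :: "('k \<Rightarrow> 'k) \<Rightarrow> 'a" where
  "limit_point f = (SOME x. \<forall>\<alpha>\<in>Field \<kappa>. x \<in> piece f \<alpha>)"

lemma limit_point_in_piece:
  assumes f: "f \<in> Field \<kappa> \<rightarrow> Field \<kappa>" and \<alpha>: "\<alpha> \<in> Field \<kappa>"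
  shows "limit_point f \<in> piece f \<alpha>"
proof -
  have "splits f \<beta> \<and> f \<beta> \<in> Field \<kappa>" if "\<beta> \<in> Field \<kappa>" for \<beta>
    using f that underS_FieldD(1) by (auto intro!: splits_all)
  then have "(\<Inter>\<alpha>\<in>Field \<kappa>. piece f \<alpha>) \<noteq> {}"
    by (rule branch_limit[OF limit_segment_Field])
  then obtain x where "\<forall>\<alpha>\<in>Field \<kappa>. x \<in> piece f \<alpha>"
    by auto
  then have "\<forall>\<alpha>\<in>Field \<kappa>. limit_point f \<in> piece f \<alpha>"
    unfolding limit_point_def by (rule someI)
  then show ?thesis using \<alpha> by blast
qed

text \<open>The piece in round \<open>\<beta>\<close> is inside the \<open>\<beta>\<close>-th basic set or disjoint from it, hence inside if it meets
  it. So the pieces along a branch through \<open>x\<close> are a neighbourhood base at \<open>x\<close>.\<close>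

lemma ex_piece_inside_open:
  assumes f: "f \<in> Field \<kappa> \<rightarrow> Field \<kappa>" and U: "openin X U" "x \<in> U"
    and x: "\<And>\<alpha>. \<alpha> \<in> Field \<kappa> \<Longrightarrow> x \<in> piece f \<alpha>"
  obtains \<beta> where "\<beta> \<in> Field \<kappa>" "piece f \<beta> \<subseteq> U"
proof -
  obtain \<beta> where \<beta>: "\<beta> \<in> Field \<kappa>" "x \<in> b \<beta>" "b \<beta> \<subseteq> U"
    using b_base[OF U] by blast
  have "splits f \<beta>" "f \<beta> \<in> Field \<kappa>"
    using f \<beta>(1) underS_FieldD(1) by (auto intro!: splits_all)
  then have "piece f \<beta> \<subseteq> b \<beta> \<or> piece f \<beta> \<inter> b \<beta> = {}"
    by (rule splits_piece)
  then have "piece f \<beta> \<subseteq> U"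
    using x[OF \<beta>(1)] \<beta>(2,3) by blast
  then show ?thesis using that \<beta>(1) by blast
qed

lemma limit_point_eq:
  assumes f: "f \<in> Field \<kappa> \<rightarrow> Field \<kappa>" and x: "x \<in> topspace X"
    "\<And>\<alpha>. \<alpha> \<in> Field \<kappa> \<Longrightarrow> x \<in> piece f \<alpha>"
  shows "limit_point f = x"
proof (rule ccontr)
  assume neq: "limit_point f \<noteq> x"
  obtain \<alpha> where \<alpha>: "\<alpha> \<in> Field \<kappa>" using Field_nonempty by blast
  have "splits f \<alpha>" "f \<alpha> \<in> Field \<kappa>"
    using f \<alpha> underS_FieldD(1) by (auto intro!: splits_all)
  then have "limit_point f \<in> topspace X"
    using limit_point_in_piece[OF f \<alpha>] splits_piece(1)[of f \<alpha>] openin_subset by blast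
  then obtain U V where UV: "openin X U" "openin X V" "x \<in> U" "limit_point f \<in> V" "disjnt U V"
    using Hausdorff x(1) neq unfolding Hausdorff_space_def by metis
  obtain \<beta> where "\<beta> \<in> Field \<kappa>" "piece f \<beta> \<subseteq> U"
    using ex_piece_inside_open[OF f UV(1,3) x(2)] .
  then show False
    using limit_point_in_piece[OF f] UV(4,5) by (auto simp: disjnt_iff)
qed

text \<open>Continuity and openness of the map both rest on this correspondence, as the cylinders are a base on
  one side and the nodes are open and arbitrarily small on the other.\<close>

lemma image_cylinder:
  assumes f: "f \<in> Field \<kappa> \<rightarrow>\<^sub>E Field \<kappa>" and \<alpha>: "\<alpha> \<in> Field \<kappa>"
  shows "limit_point ` cylinder \<alpha> f = node f \<alpha>"
proof
  show "limit_point ` cylinder \<alpha> f \<subseteq> node f \<alpha>"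
  proof clarify
    fix g assume "g \<in> cylinder \<alpha> f"
    then have g: "g \<in> Field \<kappa> \<rightarrow> Field \<kappa>" "\<And>\<beta>. \<beta> \<in> underS \<kappa> \<alpha> \<Longrightarrow> f \<beta> = g \<beta>"
      by (auto simp: cylinder_def)
    have "splits g \<alpha>" "g \<alpha> \<in> Field \<kappa>"
      using g \<alpha> underS_FieldD(1) by (auto intro!: splits_all)
    then have "piece g \<alpha> \<subseteq> node g \<alpha>" by (rule splits_piece)
    moreover have "node g \<alpha> = node f \<alpha>" using g(2) by (intro node_cong) simp
    ultimately show "limit_point g \<in> node f \<alpha>"
      using limit_point_in_piece[OF g(1) \<alpha>] by blast
  qed
  show "node f \<alpha> \<subseteq> limit_point ` cylinder \<alpha> f"
  proof
    fix x assume x: "x \<in> node f \<alpha>"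
    then have x_top: "x \<in> topspace X" by (simp add: mem_node)
    obtain g where g: "g \<in> Field \<kappa> \<rightarrow>\<^sub>E Field \<kappa>" "\<And>\<alpha>. \<alpha> \<in> Field \<kappa> \<Longrightarrow> x \<in> piece g \<alpha>"
      by (rule ex_branch_through[OF x_top]) blast
    have fg: "f \<in> Field \<kappa> \<rightarrow> Field \<kappa>" "g \<in> Field \<kappa> \<rightarrow> Field \<kappa>"
      using f g(1) by auto
    have "g \<beta> = f \<beta>" if \<beta>: "\<beta> \<in> underS \<kappa> \<alpha>" for \<beta>
    proof (rule ccontr)
      assume "g \<beta> \<noteq> f \<beta>"
      then obtain \<gamma> where \<gamma>: "\<gamma> \<in> Field \<kappa>" "\<gamma> \<in> underS \<kappa> \<alpha> \<and> f \<gamma> \<noteq> g \<gamma>"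
        and least: "\<And>\<delta>. \<delta> \<in> underS \<kappa> \<gamma> \<Longrightarrow> \<not> (\<delta> \<in> underS \<kappa> \<alpha> \<and> f \<delta> \<noteq> g \<delta>)"
        using ex_least[of \<beta> "\<lambda>\<beta>. \<beta> \<in> underS \<kappa> \<alpha> \<and> f \<beta> \<noteq> g \<beta>"] \<beta> underS_FieldD(1) by metis
      have "piece f \<gamma> \<inter> piece g \<gamma> = {}"
        using least underS_trans \<gamma>(2) by (intro piece_disjoint[OF fg \<gamma>(1)]) blast+
      moreover have "x \<in> piece f \<gamma>" using x \<gamma>(2) by (simp add: mem_node)
      ultimately show False using g(2)[OF \<gamma>(1)] by blast
    qed
    then have "g \<in> cylinder \<alpha> f" using g(1) by (simp add: cylinder_def)
    moreover have "limit_point g = x" using limit_point_eq[OF fg(2) x_top g(2)] .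
    ultimately show "x \<in> limit_point ` cylinder \<alpha> f" by blast
  qed
qed

lemma homeomorphic_map_limit_point: "homeomorphic_map Baire X limit_point"
proof (rule bijective_open_imp_homeomorphic_map)
  have open_node: "openin X (node f \<alpha>)" if "f \<in> Field \<kappa> \<rightarrow>\<^sub>E Field \<kappa>" "\<alpha> \<in> Field \<kappa>" for f \<alpha>
    using that underS_FieldD(1) underS_trans
    by (intro openin_node conjI splits_all) (auto dest: PiE_mem)
  have in_top: "limit_point f \<in> topspace X" if f: "f \<in> Field \<kappa> \<rightarrow>\<^sub>E Field \<kappa>" for f
  proof -
    obtain \<alpha> where \<alpha>: "\<alpha> \<in> Field \<kappa>" using Field_nonempty by blast
    have "limit_point f \<in> node f \<alpha>"
      unfolding image_cylinder[OF f \<alpha>, symmetric] using cylinder_self[OF f] by (rule imageI)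
    then show ?thesis by (simp add: mem_node)
  qed
  show "open_map Baire X limit_point"
    unfolding open_map_def
  proof (intro allI impI)
    fix S assume S: "openin Baire S"
    show "openin X (limit_point ` S)"
    proof (subst openin_subopen, intro ballI)
      fix y assume "y \<in> limit_point ` S"
      then obtain f where f: "f \<in> S" "y = limit_point f" by blast
      obtain \<alpha> where \<alpha>: "\<alpha> \<in> Field \<kappa>" "cylinder \<alpha> f \<subseteq> S" and f': "f \<in> Field \<kappa> \<rightarrow>\<^sub>E Field \<kappa>"
        using S f(1) unfolding openin_Baire by blast
      have img: "limit_point ` cylinder \<alpha> f = node f \<alpha>" using image_cylinder[OF f' \<alpha>(1)] .
      have "node f \<alpha> \<subseteq> limit_point ` S" "y \<in> node f \<alpha>"
        unfolding img[symmetric] using \<alpha>(2) cylinder_self[OF f'] f(2) by auto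
      then show "\<exists>T. openin X T \<and> y \<in> T \<and> T \<subseteq> limit_point ` S"
        using open_node[OF f' \<alpha>(1)] by (intro exI[of _ "node f \<alpha>"]) simp
    qed
  qed
  show "continuous_map Baire X limit_point"
    unfolding continuous_map_def topspace_Baire
  proof (intro conjI allI impI)
    show "limit_point \<in> (Field \<kappa> \<rightarrow>\<^sub>E Field \<kappa>) \<rightarrow> topspace X" using in_top by blast
  next
    fix U assume U: "openin X U"
    show "openin Baire {f \<in> Field \<kappa> \<rightarrow>\<^sub>E Field \<kappa>. limit_point f \<in> U}"
      unfolding openin_Baire
    proof (intro conjI ballI)
      fix f assume "f \<in> {f \<in> Field \<kappa> \<rightarrow>\<^sub>E Field \<kappa>. limit_point f \<in> U}"
      then have f: "f \<in> Field \<kappa> \<rightarrow>\<^sub>E Field \<kappa>" "limit_point f \<in> U" by auto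
      then have f_Pi: "f \<in> Field \<kappa> \<rightarrow> Field \<kappa>" by auto
      obtain \<beta> where \<beta>: "\<beta> \<in> Field \<kappa>" "piece f \<beta> \<subseteq> U"
        using ex_piece_inside_open[OF f_Pi U f(2) limit_point_in_piece[OF f_Pi]] .
      obtain \<alpha> where \<alpha>: "\<alpha> \<in> Field \<kappa>" "\<beta> \<in> underS \<kappa> \<alpha>"
        using no_greatest[OF \<beta>(1)] .
      have "node f \<alpha> \<subseteq> U" using \<beta>(2) \<alpha>(2) by (auto simp: mem_node)
      then have "limit_point ` cylinder \<alpha> f \<subseteq> U" using image_cylinder[OF f(1) \<alpha>(1)] by simp
      then have "cylinder \<alpha> f \<subseteq> {f \<in> Field \<kappa> \<rightarrow>\<^sub>E Field \<kappa>. limit_point f \<in> U}"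
        using cylinder_subset[of \<alpha> f] by auto
      then show "\<exists>\<alpha>\<in>Field \<kappa>. cylinder \<alpha> f \<subseteq> {f \<in> Field \<kappa> \<rightarrow>\<^sub>E Field \<kappa>. limit_point f \<in> U}"
        using \<alpha>(1) by (rule_tac bexI)
    qed auto
  qed
  show "limit_point ` topspace Baire = topspace X"
    unfolding topspace_Baire
  proof
    show "limit_point ` (Field \<kappa> \<rightarrow>\<^sub>E Field \<kappa>) \<subseteq> topspace X" using in_top by blast
    show "topspace X \<subseteq> limit_point ` (Field \<kappa> \<rightarrow>\<^sub>E Field \<kappa>)"
    proof
      fix x assume x: "x \<in> topspace X"
      obtain f where f: "f \<in> Field \<kappa> \<rightarrow>\<^sub>E Field \<kappa>" "\<And>\<alpha>. \<alpha> \<in> Field \<kappa> \<Longrightarrow> x \<in> piece f \<alpha>"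
        by (rule ex_branch_through[OF x]) blast
      then have "limit_point f = x" using x by (intro limit_point_eq) auto
      then show "x \<in> limit_point ` (Field \<kappa> \<rightarrow>\<^sub>E Field \<kappa>)" using f(1) by blast
    qed
  qed
  show "inj_on limit_point (topspace Baire)"
    unfolding topspace_Baire
  proof (rule inj_onI)
    fix f g assume f: "f \<in> Field \<kappa> \<rightarrow>\<^sub>E Field \<kappa>" and g: "g \<in> Field \<kappa> \<rightarrow>\<^sub>E Field \<kappa>"
      and eq: "limit_point f = limit_point g"
    have fg: "f \<in> Field \<kappa> \<rightarrow> Field \<kappa>" "g \<in> Field \<kappa> \<rightarrow> Field \<kappa>"
      using f g by auto
    have "f \<alpha> = g \<alpha>" if "\<alpha> \<in> Field \<kappa>" for \<alpha>
    proof (rule ccontr)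
      assume "f \<alpha> \<noteq> g \<alpha>"
      then obtain \<gamma> where \<gamma>: "\<gamma> \<in> Field \<kappa>" "f \<gamma> \<noteq> g \<gamma>"
        and least: "\<And>\<delta>. \<delta> \<in> underS \<kappa> \<gamma> \<Longrightarrow> \<not> f \<delta> \<noteq> g \<delta>"
        using ex_least[of \<alpha> "\<lambda>\<alpha>. f \<alpha> \<noteq> g \<alpha>"] \<open>\<alpha> \<in> Field \<kappa>\<close> by metis
      have "piece f \<gamma> \<inter> piece g \<gamma> = {}"
        using least \<gamma>(2) by (intro piece_disjoint[OF fg \<gamma>(1)]) blast+
      then show False
        using limit_point_in_piece[OF fg(1) \<gamma>(1)] limit_point_in_piece[OF fg(2) \<gamma>(1)] eq by auto
    qed
    then show "f = g" using f g by (intro PiE_ext)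
  qed
qed

end

context uncountable_regular
begin

lemma homeomorphic_Baire:
  assumes "topspace X \<noteq> {}" "kappa_additive \<kappa> X" "SC_space \<kappa> X" "Lindelof_sets_empty_interior \<kappa> X"
  shows "X homeomorphic_space Baire"
proof -
  have X: "regular_space X" "Hausdorff_space X" "weight_le \<kappa> X"
    using assms(3) by (auto simp: SC_space_def)
  obtain \<sigma> where \<sigma>: "choquet_winning_II \<kappa> X \<sigma>"
    using assms(3) by (auto simp: SC_space_def)
  obtain b where b: "\<And>\<beta>. \<beta> \<in> Field \<kappa> \<Longrightarrow> openin X (b \<beta>) \<and> closedin X (b \<beta>)"
    "\<And>U x. openin X U \<Longrightarrow> x \<in> U \<Longrightarrow> \<exists>\<beta>\<in>Field \<kappa>. x \<in> b \<beta> \<and> b \<beta> \<subseteq> U"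
    by (rule clopen_base[OF assms(2) X(1,3) assms(1)]) blast
  interpret choquet_scheme \<kappa> X \<sigma> b
    by unfold_locales (use assms X \<sigma> b in auto)
  have "Baire homeomorphic_space X"
    using homeomorphic_map_limit_point by (rule homeomorphic_map_imp_homeomorphic_space)
  then show ?thesis using homeomorphic_space_sym by blast
qed

end

theorem theorem3p9:
  fixes \<kappa> :: "'k rel"
  assumes "Card_order \<kappa>" and "natLeq <o \<kappa>" and "regularCard \<kappa>"
    and "two_power_less \<kappa> =o \<kappa>"
  shows "(topspace (generalized_Baire_space \<kappa>) \<noteq> {} \<and>
          kappa_additive \<kappa> (generalized_Baire_space \<kappa>) \<and>
          SC_space \<kappa> (generalized_Baire_space \<kappa>) \<and>
          Lindelof_sets_empty_interior \<kappa> (generalized_Baire_space \<kappa>) \<and>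
          (\<forall>X :: 'a topology.
             topspace X \<noteq> {} \<and> kappa_additive \<kappa> X \<and> SC_space \<kappa> X \<and>
             Lindelof_sets_empty_interior \<kappa> X \<longrightarrow>
             X homeomorphic_space generalized_Baire_space \<kappa>))
       \<and> (topspace (generalized_Baire_space \<kappa>) \<noteq> {} \<and>
          kappa_additive \<kappa> (generalized_Baire_space \<kappa>) \<and>
          SC_space \<kappa> (generalized_Baire_space \<kappa>) \<and>
          K_kappa_sets_empty_interior \<kappa> (generalized_Baire_space \<kappa>) \<and>
          (\<forall>X :: 'a topology.
             topspace X \<noteq> {} \<and> kappa_additive \<kappa> X \<and> SC_space \<kappa> X \<and>
             K_kappa_sets_empty_interior \<kappa> X \<longrightarrow>
             X homeomorphic_space generalized_Baire_space \<kappa>))"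
proof -
  interpret uncountable_regular \<kappa>
    using assms(1-3) by unfold_locales
  have "topspace Baire \<noteq> {}"
    using Field_nonempty by (simp add: topspace_Baire PiE_eq_empty_iff)
  moreover have "X homeomorphic_space Baire"
    if "topspace X \<noteq> {} \<and> kappa_additive \<kappa> X \<and> SC_space \<kappa> X \<and> Lindelof_sets_empty_interior \<kappa> X"
    for X :: "'a topology"
    using that homeomorphic_Baire[of X] by simp
  moreover have "X homeomorphic_space Baire"
    if "topspace X \<noteq> {} \<and> kappa_additive \<kappa> X \<and> SC_space \<kappa> X \<and> K_kappa_sets_empty_interior \<kappa> X"
    for X :: "'a topology"
    using that homeomorphic_Baire[of X] Lindelof_sets_empty_interior_if_K_kappa[of X] by simp
  ultimately show ?thesis
    using kappa_additive_Baire SC_space_Baire[OF assms(4)] K_kappa_sets_empty_interior_Baire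
      Lindelof_sets_empty_interior_if_K_kappa[OF K_kappa_sets_empty_interior_Baire]
    by simp
qed

end
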